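(* Let $N\ge2$ be an integer, fix $j\in\{2,\dots,N\}$, and let $\varphi,\psi$ be real elements of $\ell^1(\mathbb Z^N)$ such that the bounded operator $T^<_\varphi+V^<_\psi$ in $\ell^2(\mathbb Z^N_<)$ is selfadjoint. For any $n\in\mathbb N$ set $$\Omega_j(n):=\{(y_1,\dots,y_N)\in\mathbb Z^N_<: y_j-y_{j-1}\ge n\}.$$ Let $\kappa:\mathbb R\to\mathbb R$ be a continuous function with $$\operatorname{supp}(\kappa)\cap\Big[\bigcup_{\tau,\tau'\in\mathbb T}\Sigma_j(\tau,\tau')\Big]=\varnothing,$$ where $\Sigma_j(\tau,\tau')$ is the spectrum of the operator $T^{N-2}_{\nu_j(\tau')\mu(\tau)\varphi}+V^{N-2}_{\nu_j(0)\mu(0)\psi}$ acting in $\ell^2[(\mathbb N^* )^{N-2}]$. Then for each $\varepsilon>0$ there exists $n_\varepsilon\in\mathbb N$ such that $$\big\|\chi_{\Omega_j(n)}\,\kappa(T^<_\varphi+V^<_\psi)\big\|\le\varepsilon$$ for each $n\ge n_\varepsilon$.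
   Context: All Hilbert spaces are complex. $\mathbb N^*:=\{1,2,\dots\}$, and $\mathbb T$ is the interval $[0,1]$ with $0$ identified to $1$. $\chi_A$ denotes the characteristic function of a set $A$ and also the corresponding multiplication operator; $\kappa(\cdot)$ is the functional calculus of a selfadjoint operator; $\operatorname{supp}$ is the (closed) support. Toeplitz operators. For a subset $E$ of $X=\mathbb Z^k$, $k\ge1$, and $\eta\in X$, let $(u_\eta f)(\xi):=f(\xi-\eta)$ on $\ell^2(X)$, let $P^E:\ell^2(X)\to\ell^2(E)$ be the projection given by multiplication by $\chi_E$, and set $v^E_\eta:=P^Eu_\eta\upharpoonright\ell^2(E)$. For $\varrho\in\ell^1(X)$ put $$T^E_\varrho:=\sum_{\eta\in X}\varrho(\eta)v^E_\eta,\qquad V^E_\varrho:=\sum_{\eta\in X}\varrho(\eta)v^E_\eta(v^E_\eta)^*,$$ bounded operators in $\ell^2(E)$. For $X=\mathbb Z^N$ and $E=\mathbb Z^N_<:=\{(x_1,\dots,x_N)\in\mathbb Z^N:x_1<x_2<\dots<x_N\}$ these are denoted $T^<_\varrho,V^<_\varrho$. For $X=\mathbb Z^k$ and $E=(\mathbb N^* )^k$ they are denoted $T^k_\varrho,V^k_\varrho$. For $k=0$, $\mathbb Z^0=(\mathbb N^* )^0=\{0\}$, functions are scalars, and $T^0_\varrho=V^0_\varrho:=\varrho\,1$ in $\ell^2(\{0\})\equiv\mathbb C$. Partial Fourier transforms. Let $\theta^{-1}:\mathbb Z^N\to\mathbb Z^N$ be $\theta^{-1}(z_1,\dots,z_N)=(z_1,z_1+z_2,\dots,z_1+\dots+z_N)$.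 For $\rho\in\ell^1(\mathbb Z^N)$ and $\tau\in\mathbb T$ define $\mu(\tau)\rho\in\ell^1(\mathbb Z^{N-1})$ by $$[\mu(\tau)\rho](z_2,\dots,z_N):=\sum_{z_1\in\mathbb Z}e^{-2\pi iz_1\tau}(\rho\circ\theta^{-1})(z_1,z_2,\dots,z_N).$$ Variables in $\mathbb Z^{N-1}$ are labelled $z_2,\dots,z_N$. For $j\in\{2,\dots,N\}$, $\varrho\in\ell^1(\mathbb Z^{N-1})$ and $\tau'\in\mathbb T$ define $\nu_j(\tau')\varrho\in\ell^1(\mathbb Z^{N-2})$ by $$[\nu_j(\tau')\varrho](z_2,\dots,z_{j-1},z_{j+1},\dots,z_N):=\sum_{z_j\in\mathbb Z}e^{-2\pi iz_j\tau'}\varrho(z_2,\dots,z_N).$$ *)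

theory Defs
  imports "HOL-Analysis.Analysis" "HOL-Computational_Algebra.Polynomial"
    "HOL-Library.Function_Algebras"
begin

section \<open>The complex Hilbert space of square-summable functions\<close>

typedef 'a ell2 = "{f :: 'a \<Rightarrow> complex. (\<lambda>x. (cmod (f x))\<^sup>2) summable_on UNIV}"
  morphisms ell2_apply Abs_ell2
proof
  show "(\<lambda>_. 0) \<in> {f :: 'a \<Rightarrow> complex. (\<lambda>x. (cmod (f x))\<^sup>2) summable_on UNIV}"
    by simp
qed

setup_lifting type_definition_ell2

lemma ell2_eqI: "(\<And>x. ell2_apply f x = ell2_apply g x) \<Longrightarrow> f = g"
  by (metis ell2_apply_inject ext)

lemma ell2_summable: "(\<lambda>x. (cmod (ell2_apply f x))\<^sup>2) summable_on UNIV"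
  using ell2_apply by blast

lemma square_summable_add:
  fixes f g :: "'a \<Rightarrow> complex"
  assumes "(\<lambda>x. (cmod (f x))\<^sup>2) summable_on UNIV" "(\<lambda>x. (cmod (g x))\<^sup>2) summable_on UNIV"
  shows "(\<lambda>x. (cmod (f x + g x))\<^sup>2) summable_on UNIV"
proof (rule summable_on_comparison_test)
  show "(\<lambda>x. 2 * (cmod (f x))\<^sup>2 + 2 * (cmod (g x))\<^sup>2) summable_on UNIV"
    by (intro summable_on_add summable_on_cmult_right assms)
  show "(cmod (f x + g x))\<^sup>2 \<le> 2 * (cmod (f x))\<^sup>2 + 2 * (cmod (g x))\<^sup>2" for x
  proof -
    have "(cmod (f x + g x))\<^sup>2 \<le> (cmod (f x) + cmod (g x))\<^sup>2"
      by (intro power_mono norm_triangle_ineq) simp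
    also have "\<dots> \<le> 2 * (cmod (f x))\<^sup>2 + 2 * (cmod (g x))\<^sup>2"
      using sum_squares_bound[of "cmod (f x)" "cmod (g x)"] by (simp add: power2_sum)
    finally show ?thesis .
  qed
qed simp

lemma square_summable_diff:
  fixes f g :: "'a \<Rightarrow> complex"
  assumes "(\<lambda>x. (cmod (f x))\<^sup>2) summable_on UNIV" "(\<lambda>x. (cmod (g x))\<^sup>2) summable_on UNIV"
  shows "(\<lambda>x. (cmod (f x - g x))\<^sup>2) summable_on UNIV"
  using square_summable_add[of f "\<lambda>x. - g x"] assms by simp

lift_definition scaleC_ell2 :: "complex \<Rightarrow> 'a ell2 \<Rightarrow> 'a ell2" is "\<lambda>c f x. c * f x"
  by (simp add: norm_mult power_mult_distrib summable_on_cmult_right)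

instantiation ell2 :: (type) real_vector
begin

lift_definition zero_ell2 :: "'a ell2" is "\<lambda>_. 0" by simp

lift_definition plus_ell2 :: "'a ell2 \<Rightarrow> 'a ell2 \<Rightarrow> 'a ell2" is "\<lambda>f g x. f x + g x"
  by (simp add: square_summable_add)

lift_definition uminus_ell2 :: "'a ell2 \<Rightarrow> 'a ell2" is "\<lambda>f x. - f x" by simp

lift_definition minus_ell2 :: "'a ell2 \<Rightarrow> 'a ell2 \<Rightarrow> 'a ell2" is "\<lambda>f g x. f x - g x"
  by (simp add: square_summable_diff)

lift_definition scaleR_ell2 :: "real \<Rightarrow> 'a ell2 \<Rightarrow> 'a ell2" is "\<lambda>r f x. r *\<^sub>R f x"
  by (simp add: power_mult_distrib summable_on_cmult_right)

instance
  by standard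
    (auto intro!: ell2_eqI simp: zero_ell2.rep_eq plus_ell2.rep_eq uminus_ell2.rep_eq
      minus_ell2.rep_eq scaleR_ell2.rep_eq algebra_simps)

end

lemma ell2_apply_zero [simp]: "ell2_apply 0 x = 0"
  by (simp add: zero_ell2.rep_eq)

lemma ell2_apply_add [simp]: "ell2_apply (f + g) x = ell2_apply f x + ell2_apply g x"
  by (simp add: plus_ell2.rep_eq)

lemma ell2_apply_uminus [simp]: "ell2_apply (- f) x = - ell2_apply f x"
  by (simp add: uminus_ell2.rep_eq)

lemma ell2_apply_diff [simp]: "ell2_apply (f - g) x = ell2_apply f x - ell2_apply g x"
  by (simp add: minus_ell2.rep_eq)

lemma ell2_apply_scaleR [simp]: "ell2_apply (r *\<^sub>R f) x = r *\<^sub>R ell2_apply f x"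
  by (simp add: scaleR_ell2.rep_eq)

lemma ell2_apply_scaleC [simp]: "ell2_apply (scaleC_ell2 c f) x = c * ell2_apply f x"
  by (simp add: scaleC_ell2.rep_eq)

definition cinner :: "'a ell2 \<Rightarrow> 'a ell2 \<Rightarrow> complex" where
  "cinner f g = (\<Sum>\<^sub>\<infinity>x. cnj (ell2_apply f x) * ell2_apply g x)"

text \<open>The inner product on \<^typ>\<open>complex\<close> used below is the real one, so that
  \<^const>\<open>inner\<close> on \<^typ>\<open>'a ell2\<close> is the real part of \<^const>\<open>cinner\<close>.\<close>

lemma ell2_inner_summable: "(\<lambda>x. ell2_apply f x \<bullet> ell2_apply g x) summable_on UNIV"
proof -
  have "(\<lambda>x. (cmod (ell2_apply f x))\<^sup>2 + (cmod (ell2_apply g x))\<^sup>2) summable_on UNIV"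
    by (intro summable_on_add ell2_summable)
  then have "(\<lambda>x. norm (ell2_apply f x \<bullet> ell2_apply g x)) summable_on UNIV"
  proof (rule Infinite_Sum.abs_summable_on_comparison_test')
    fix x
    have "norm (ell2_apply f x \<bullet> ell2_apply g x) \<le> cmod (ell2_apply f x) * cmod (ell2_apply g x)"
      by (simp add: Cauchy_Schwarz_ineq2)
    also have "\<dots> \<le> (cmod (ell2_apply f x))\<^sup>2 + (cmod (ell2_apply g x))\<^sup>2"
    proof -
      have "0 \<le> cmod (ell2_apply f x) * cmod (ell2_apply g x)"
        by (intro mult_nonneg_nonneg norm_ge_zero)
      with sum_squares_bound[of "cmod (ell2_apply f x)" "cmod (ell2_apply g x)"]
      show ?thesis by linarith
    qed
    finally show "norm (ell2_apply f x \<bullet> ell2_apply g x)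
        \<le> (cmod (ell2_apply f x))\<^sup>2 + (cmod (ell2_apply g x))\<^sup>2" .
  qed
  then show ?thesis by (rule abs_summable_summable)
qed

instantiation ell2 :: (type) real_inner
begin

definition inner_ell2 :: "'a ell2 \<Rightarrow> 'a ell2 \<Rightarrow> real" where
  "inner_ell2 f g = (\<Sum>\<^sub>\<infinity>x. ell2_apply f x \<bullet> ell2_apply g x)"

definition norm_ell2 :: "'a ell2 \<Rightarrow> real" where
  "norm_ell2 f = sqrt (inner f f)"

definition sgn_ell2 :: "'a ell2 \<Rightarrow> 'a ell2" where
  "sgn_ell2 f = f /\<^sub>R norm f"

definition dist_ell2 :: "'a ell2 \<Rightarrow> 'a ell2 \<Rightarrow> real" where
  "dist_ell2 f g = norm (f - g)"

definition uniformity_ell2 :: "('a ell2 \<times> 'a ell2) filter" where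
  "uniformity_ell2 = (INF e\<in>{0<..}. principal {(f, g). dist f g < e})"

definition open_ell2 :: "'a ell2 set \<Rightarrow> bool" where
  "open_ell2 U = (\<forall>f\<in>U. eventually (\<lambda>(f', g). f' = f \<longrightarrow> g \<in> U) uniformity)"

instance
proof
  fix f g h :: "'a ell2" and r :: real
  show "inner f g = inner g f"
    by (simp add: inner_ell2_def inner_commute)
  show "inner (f + g) h = inner f h + inner g h"
    by (simp add: inner_ell2_def inner_add_left infsum_add ell2_inner_summable)
  show "inner (r *\<^sub>R f) g = r * inner f g"
    by (simp add: inner_ell2_def infsum_cmult_right')
  show "0 \<le> inner f f"
    by (simp add: inner_ell2_def infsum_nonneg)
  show "inner f f = 0 \<longleftrightarrow> f = 0"
  proof
    assume "inner f f = 0"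
    then have "ell2_apply f x \<bullet> ell2_apply f x = 0" for x
      using nonneg_infsum_le_0D[OF _ ell2_inner_summable[of f f], of x] by (simp add: inner_ell2_def)
    then show "f = 0"
      by (intro ell2_eqI) simp
  qed (simp add: inner_ell2_def)
qed (simp_all add: norm_ell2_def sgn_ell2_def dist_ell2_def uniformity_ell2_def open_ell2_def)

end

lemma norm_ell2_power2: "(norm f)\<^sup>2 = (\<Sum>\<^sub>\<infinity>x. (cmod (ell2_apply f x))\<^sup>2)"
  unfolding power2_norm_eq_inner inner_ell2_def ..

lemma sum_le_norm_ell2_power2:
  "finite S \<Longrightarrow> (\<Sum>x\<in>S. (cmod (ell2_apply f x))\<^sup>2) \<le> (norm f)\<^sup>2"
  unfolding norm_ell2_power2 by (rule finite_sum_le_infsum[OF ell2_summable]) auto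

lemma cmod_ell2_apply_le: "cmod (ell2_apply f x) \<le> norm f"
proof (rule power2_le_imp_le)
  show "(cmod (ell2_apply f x))\<^sup>2 \<le> (norm f)\<^sup>2"
    using sum_le_norm_ell2_power2[of "{x}" f] by simp
qed simp

lemma norm_ell2_le:
  assumes "0 \<le> C" "\<And>S. finite S \<Longrightarrow> (\<Sum>x\<in>S. (cmod (ell2_apply f x))\<^sup>2) \<le> C\<^sup>2"
  shows "norm f \<le> C"
proof (rule power2_le_imp_le)
  show "(norm f)\<^sup>2 \<le> C\<^sup>2"
    unfolding norm_ell2_power2 by (rule infsum_le_finite_sums[OF ell2_summable assms(2)])
qed (fact assms(1))

instance ell2 :: (type) banach
proof
  fix F :: "nat \<Rightarrow> 'a ell2"
  assume F: "Cauchy F"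
  have "Cauchy (\<lambda>n. ell2_apply (F n) x)" for x
  proof (rule CauchyI)
    fix e :: real assume "0 < e"
    from CauchyD[OF F this] obtain M where M: "\<forall>m\<ge>M. \<forall>n\<ge>M. norm (F m - F n) < e" by blast
    have "norm (ell2_apply (F m) x - ell2_apply (F n) x) < e" if "m \<ge> M" "n \<ge> M" for m n
      using cmod_ell2_apply_le[of "F m - F n" x] M that by fastforce
    then show "\<exists>M. \<forall>m\<ge>M. \<forall>n\<ge>M. norm (ell2_apply (F m) x - ell2_apply (F n) x) < e" by blast
  qed
  then have "\<exists>l. (\<lambda>n. ell2_apply (F n) x) \<longlonglongrightarrow> l" for x
    by (simp add: Cauchy_convergent_iff convergent_def)
  then obtain g where g: "\<And>x. (\<lambda>n. ell2_apply (F n) x) \<longlonglongrightarrow> g x" by metis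
  have bound: "(\<Sum>x\<in>S. (cmod (ell2_apply (F n) x - g x))\<^sup>2) \<le> e\<^sup>2"
    if "finite S" "n \<ge> M" "\<forall>m\<ge>M. \<forall>n\<ge>M. norm (F m - F n) < e" for S n M e
  proof (rule LIMSEQ_le_const2)
    show "(\<lambda>m. \<Sum>x\<in>S. (cmod (ell2_apply (F n) x - ell2_apply (F m) x))\<^sup>2)
        \<longlonglongrightarrow> (\<Sum>x\<in>S. (cmod (ell2_apply (F n) x - g x))\<^sup>2)"
      by (intro tendsto_intros g)
    have "(\<Sum>x\<in>S. (cmod (ell2_apply (F n) x - ell2_apply (F m) x))\<^sup>2) \<le> e\<^sup>2" if "m \<ge> M" for m
    proof -
      have "(\<Sum>x\<in>S. (cmod (ell2_apply (F n - F m) x))\<^sup>2) \<le> (norm (F n - F m))\<^sup>2"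
        by (rule sum_le_norm_ell2_power2) fact
      also have "\<dots> \<le> e\<^sup>2"
        using \<open>\<forall>m\<ge>M. \<forall>n\<ge>M. norm (F m - F n) < e\<close> \<open>n \<ge> M\<close> that by (intro power_mono) (auto intro: less_imp_le)
      finally show ?thesis by simp
    qed
    then show "\<exists>N. \<forall>m\<ge>N. (\<Sum>x\<in>S. (cmod (ell2_apply (F n) x - ell2_apply (F m) x))\<^sup>2) \<le> e\<^sup>2"
      by blast
  qed
  from CauchyD[OF F, of 1] obtain M1 where M1: "\<forall>m\<ge>M1. \<forall>n\<ge>M1. norm (F m - F n) < 1" by auto
  have "(\<lambda>x. (cmod (ell2_apply (F M1) x - g x))\<^sup>2) summable_on UNIV"
    by (rule nonneg_bdd_above_summable_on)
      (use bound[OF _ order_refl M1] in \<open>auto intro!: bdd_aboveI2\<close>)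
  from square_summable_add[OF ell2_summable[of "- F M1"] this]
  have "(\<lambda>x. (cmod (g x))\<^sup>2) summable_on UNIV" by simp
  then obtain G where G: "ell2_apply G = g"
    using Abs_ell2_inverse by blast
  have "F \<longlonglongrightarrow> G"
  proof (rule LIMSEQ_I)
    fix r :: real assume "0 < r"
    then obtain M where M: "\<forall>m\<ge>M. \<forall>n\<ge>M. norm (F m - F n) < r / 2"
      using CauchyD[OF F, of "r / 2"] by auto
    have "norm (F n - G) \<le> r / 2" if "n \<ge> M" for n
      by (rule norm_ell2_le) (use \<open>0 < r\<close> bound[OF _ that M] G in auto)
    then show "\<exists>no. \<forall>n\<ge>no. norm (F n - G) < r"
      using \<open>0 < r\<close> by (intro exI[of _ M]) fastforce
  qed
  then show "convergent F" by (rule convergentI)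
qed

section \<open>Bounded operators in subspaces of functions supported in a set\<close>

text \<open>For a set \<open>E\<close> of indices, the Hilbert space of square-summable functions on \<open>E\<close> is identified
  with the elements of \<^typ>\<open>'a ell2\<close> vanishing outside \<open>E\<close>, and a bounded operator in it with its
  extension by zero on the orthogonal complement. Thus the operators in that space are the
  complex-linear \<open>A\<close> with \<open>A = \<chi>\<^sub>E A \<chi>\<^sub>E\<close>, its identity operator is \<open>\<chi>\<^sub>E\<close>, and operator norms
  and adjoints do not depend on whether they are taken on \<open>E\<close> or on all indices.\<close>

type_synonym 'a ell2_op = "'a ell2 \<Rightarrow>\<^sub>L 'a ell2"

lemma bounded_linear_ell2I:
  assumes "\<And>f g. T (f + g) = T f + T g" "\<And>r f. T (r *\<^sub>R f) = r *\<^sub>R T f"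
    and "0 \<le> C"
    and "\<And>f S. finite S \<Longrightarrow> (\<Sum>x\<in>S. (cmod (ell2_apply (T f) x))\<^sup>2) \<le> (C * norm f)\<^sup>2"
  shows "bounded_linear T"
  by (rule bounded_linear_intro[where K = C])
    (use assms in \<open>auto intro!: norm_ell2_le simp: mult.commute[of _ C]\<close>)

lemma square_summable_restrict:
  fixes f :: "'a \<Rightarrow> complex"
  assumes "(\<lambda>x. (cmod (f x))\<^sup>2) summable_on UNIV"
  shows "(\<lambda>x. (cmod (if x \<in> E then f x else 0))\<^sup>2) summable_on UNIV"
  using assms by (rule summable_on_comparison_test) auto

lift_definition chi_ell2 :: "'a set \<Rightarrow> 'a ell2 \<Rightarrow> 'a ell2" is
  "\<lambda>E f x. if x \<in> E then f x else 0"
  by (simp add: square_summable_restrict)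

lemma ell2_apply_chi [simp]:
  "ell2_apply (chi_ell2 E f) x = (if x \<in> E then ell2_apply f x else 0)"
  by (simp add: chi_ell2.rep_eq)

lemma bounded_linear_chi_ell2: "bounded_linear (chi_ell2 E)"
proof (rule bounded_linear_ell2I[where C = 1])
  fix S :: "'a set" and f :: "'a ell2"
  assume "finite S"
  then have "(\<Sum>x\<in>S. (cmod (ell2_apply f x))\<^sup>2) \<le> (norm f)\<^sup>2"
    by (rule sum_le_norm_ell2_power2)
  moreover have "(\<Sum>x\<in>S. (cmod (ell2_apply (chi_ell2 E f) x))\<^sup>2) \<le> (\<Sum>x\<in>S. (cmod (ell2_apply f x))\<^sup>2)"
    by (rule sum_mono) simp
  ultimately show "(\<Sum>x\<in>S. (cmod (ell2_apply (chi_ell2 E f) x))\<^sup>2) \<le> (1 * norm f)\<^sup>2"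
    by simp
qed (auto intro: ell2_eqI)

definition chi :: "'a set \<Rightarrow> 'a ell2_op" where
  "chi E = Blinfun (chi_ell2 E)"

lemma chi_apply [simp]: "blinfun_apply (chi E) f = chi_ell2 E f"
  by (simp add: chi_def bounded_linear_Blinfun_apply bounded_linear_chi_ell2)

lemma bounded_linear_scaleC_ell2: "bounded_linear (scaleC_ell2 c)"
proof (rule bounded_linear_ell2I[where C = "cmod c"])
  fix S :: "'a set" and f :: "'a ell2"
  assume "finite S"
  then show "(\<Sum>x\<in>S. (cmod (ell2_apply (scaleC_ell2 c f) x))\<^sup>2) \<le> (cmod c * norm f)\<^sup>2"
    using sum_le_norm_ell2_power2[of S f]
    by (simp add: norm_mult power_mult_distrib mult_left_mono flip: sum_distrib_left)
qed (auto intro!: ell2_eqI simp: algebra_simps)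

definition scaleC_op :: "complex \<Rightarrow> 'a ell2_op \<Rightarrow> 'a ell2_op" (infixr "*\<^sub>C" 75) where
  "c *\<^sub>C A = Blinfun (scaleC_ell2 c) o\<^sub>L A"

lemma scaleC_op_apply [simp]: "blinfun_apply (c *\<^sub>C A) f = scaleC_ell2 c (blinfun_apply A f)"
  by (simp add: scaleC_op_def bounded_linear_Blinfun_apply bounded_linear_scaleC_ell2)

definition bounded_op_in :: "'a set \<Rightarrow> 'a ell2_op \<Rightarrow> bool" where
  "bounded_op_in E A \<longleftrightarrow>
     (\<forall>c f. blinfun_apply A (scaleC_ell2 c f) = scaleC_ell2 c (blinfun_apply A f)) \<and>
     A = chi E o\<^sub>L A o\<^sub>L chi E"

definition adj :: "'a ell2_op \<Rightarrow> 'a ell2_op" where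
  "adj A = (THE B. \<forall>f g. cinner (blinfun_apply A f) g = cinner f (blinfun_apply B g))"

definition selfadjoint :: "'a ell2_op \<Rightarrow> bool" where
  "selfadjoint A \<longleftrightarrow> (\<forall>f g. cinner (blinfun_apply A f) g = cinner f (blinfun_apply A g))"

definition spectrum_in :: "'a set \<Rightarrow> 'a ell2_op \<Rightarrow> complex set" where
  "spectrum_in E A = {c. \<not> (\<exists>B. bounded_op_in E B \<and>
     (A - c *\<^sub>C chi E) o\<^sub>L B = chi E \<and> B o\<^sub>L (A - c *\<^sub>C chi E) = chi E)}"

text \<open>Powers start at the identity \<^term>\<open>chi E\<close> of the space of functions on \<open>E\<close>.\<close>

definition poly_op :: "'a set \<Rightarrow> real poly \<Rightarrow> 'a ell2_op \<Rightarrow> 'a ell2_op" where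
  "poly_op E p A = (\<Sum>i\<le>degree p. coeff p i *\<^sub>R ((\<lambda>B. A o\<^sub>L B) ^^ i) (chi E))"

text \<open>The continuous functional calculus of a selfadjoint \<open>A\<close> in the space of functions on \<open>E\<close>:
  \<open>\<kappa>(A)\<close> is the norm limit of \<open>p\<^sub>n(A)\<close> for every sequence of polynomials \<open>p\<^sub>n\<close> converging to \<open>\<kappa>\<close>
  uniformly on the spectrum.\<close>

definition fun_calc :: "'a set \<Rightarrow> (real \<Rightarrow> real) \<Rightarrow> 'a ell2_op \<Rightarrow> 'a ell2_op" where
  "fun_calc E \<kappa> A = (THE B. \<forall>p :: nat \<Rightarrow> real poly.
     uniform_limit {t. complex_of_real t \<in> spectrum_in E A} (\<lambda>n. poly (p n)) \<kappa> sequentially \<longrightarrow>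
     (\<lambda>n. poly_op E (p n) A) \<longlonglongrightarrow> B)"

section \<open>Toeplitz operators\<close>

lemma square_summable_shift:
  fixes f :: "'a::ab_group_add \<Rightarrow> complex"
  assumes "(\<lambda>x. (cmod (f x))\<^sup>2) summable_on UNIV"
  shows "(\<lambda>x. (cmod (f (x - \<eta>)))\<^sup>2) summable_on UNIV"
proof -
  have "bij_betw (\<lambda>x. x - \<eta>) UNIV UNIV"
    by (rule bij_betw_byWitness[where f' = "\<lambda>x. x + \<eta>"]) auto
  from summable_on_reindex_bij_betw[OF this, of "\<lambda>x. (cmod (f x))\<^sup>2"] assms
  show ?thesis by simp
qed

text \<open>\<open>(u\<^sub>\<eta> f)(\<xi>) = f(\<xi> - \<eta>)\<close>\<close>

lift_definition shift_ell2 :: "'a::ab_group_add \<Rightarrow> 'a ell2 \<Rightarrow> 'a ell2" is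
  "\<lambda>\<eta> f \<xi>. f (\<xi> - \<eta>)"
  by (simp add: square_summable_shift)

lemma ell2_apply_shift [simp]: "ell2_apply (shift_ell2 \<eta> f) \<xi> = ell2_apply f (\<xi> - \<eta>)"
  by (simp add: shift_ell2.rep_eq)

lemma bounded_linear_shift_ell2: "bounded_linear (shift_ell2 \<eta>)"
proof (rule bounded_linear_ell2I[where C = 1])
  fix S :: "'a set" and f :: "'a ell2"
  assume "finite S"
  have "(\<Sum>\<xi>\<in>S. (cmod (ell2_apply (shift_ell2 \<eta> f) \<xi>))\<^sup>2)
      = (\<Sum>x\<in>(\<lambda>\<xi>. \<xi> - \<eta>) ` S. (cmod (ell2_apply f x))\<^sup>2)"
    by (subst sum.reindex) (auto intro: inj_onI)
  also have "\<dots> \<le> (norm f)\<^sup>2"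
    using \<open>finite S\<close> by (intro sum_le_norm_ell2_power2) simp
  finally show "(\<Sum>\<xi>\<in>S. (cmod (ell2_apply (shift_ell2 \<eta> f) \<xi>))\<^sup>2) \<le> (1 * norm f)\<^sup>2"
    by simp
qed (auto intro: ell2_eqI)

definition shift :: "'a::ab_group_add \<Rightarrow> 'a ell2_op" where
  "shift \<eta> = Blinfun (shift_ell2 \<eta>)"

lemma shift_apply [simp]: "blinfun_apply (shift \<eta>) f = shift_ell2 \<eta> f"
  by (simp add: shift_def bounded_linear_Blinfun_apply bounded_linear_shift_ell2)

definition compressed_shift :: "'a::ab_group_add set \<Rightarrow> 'a \<Rightarrow> 'a ell2_op" where
  "compressed_shift E \<eta> = chi E o\<^sub>L shift \<eta> o\<^sub>L chi E"

text \<open>Both series range over a subgroup \<open>X\<close> of the index type containing \<open>E\<close>; for \<open>\<rho>\<close> absolutely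
  summable on \<open>X\<close> they converge absolutely in operator norm.\<close>

definition toeplitz_T :: "'a::ab_group_add set \<Rightarrow> 'a set \<Rightarrow> ('a \<Rightarrow> complex) \<Rightarrow> 'a ell2_op" where
  "toeplitz_T X E \<rho> = (\<Sum>\<^sub>\<infinity>\<eta>\<in>X. \<rho> \<eta> *\<^sub>C compressed_shift E \<eta>)"

definition toeplitz_V :: "'a::ab_group_add set \<Rightarrow> 'a set \<Rightarrow> ('a \<Rightarrow> complex) \<Rightarrow> 'a ell2_op" where
  "toeplitz_V X E \<rho> =
     (\<Sum>\<^sub>\<infinity>\<eta>\<in>X. \<rho> \<eta> *\<^sub>C (compressed_shift E \<eta> o\<^sub>L adj (compressed_shift E \<eta>)))"

section \<open>Lattices and partial Fourier transforms\<close>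

text \<open>Points whose coordinates are labelled by a finite set \<open>I\<close> of natural numbers are functions
  vanishing outside \<open>I\<close>; they form a subgroup of \<^typ>\<open>nat \<Rightarrow> int\<close> under pointwise addition. For
  \<open>I = {}\<close> the lattice and its positive cone are both the singleton \<open>{0}\<close>, on which both kinds of
  Toeplitz operators are multiplication by the scalar \<open>\<rho> 0\<close>.\<close>

definition int_lattice :: "nat set \<Rightarrow> (nat \<Rightarrow> int) set" where
  "int_lattice I = {x. \<forall>i. i \<notin> I \<longrightarrow> x i = 0}"

definition positive_cone :: "nat set \<Rightarrow> (nat \<Rightarrow> int) set" where
  "positive_cone I = {x \<in> int_lattice I. \<forall>i\<in>I. 1 \<le> x i}"

definition ordered_cone :: "nat \<Rightarrow> (nat \<Rightarrow> int) set" where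
  "ordered_cone N = {x \<in> int_lattice {1..N}. \<forall>i\<in>{1..<N}. x i < x (Suc i)}"

definition theta_inv :: "nat \<Rightarrow> (nat \<Rightarrow> int) \<Rightarrow> nat \<Rightarrow> int" where
  "theta_inv N z = (\<lambda>i. if i \<in> {1..N} then \<Sum>l=1..i. z l else 0)"

text \<open>\<open>mu\<close> yields functions on \<^term>\<open>int_lattice {2..N}\<close>, and \<open>nu j\<close> applied to such functions
  yields functions on \<^term>\<open>int_lattice ({2..N} - {j})\<close>.\<close>

definition mu :: "nat \<Rightarrow> real \<Rightarrow> ((nat \<Rightarrow> int) \<Rightarrow> complex) \<Rightarrow> (nat \<Rightarrow> int) \<Rightarrow> complex" where
  "mu N \<tau> \<rho> z = (\<Sum>\<^sub>\<infinity>k::int.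
     exp (- 2 * complex_of_real pi * \<i> * of_int k * complex_of_real \<tau>) * \<rho> (theta_inv N (z(1 := k))))"

definition nu :: "nat \<Rightarrow> real \<Rightarrow> ((nat \<Rightarrow> int) \<Rightarrow> complex) \<Rightarrow> (nat \<Rightarrow> int) \<Rightarrow> complex" where
  "nu j \<tau> \<rho> z = (\<Sum>\<^sub>\<infinity>k::int.
     exp (- 2 * complex_of_real pi * \<i> * of_int k * complex_of_real \<tau>) * \<rho> (z(j := k)))"

definition fiber_spectrum ::
  "nat \<Rightarrow> nat \<Rightarrow> ((nat \<Rightarrow> int) \<Rightarrow> complex) \<Rightarrow> ((nat \<Rightarrow> int) \<Rightarrow> complex) \<Rightarrow> real \<Rightarrow> real \<Rightarrow> complex set"
  where
  "fiber_spectrum N j \<phi> \<psi> \<tau> \<tau>' =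
     (let I = {2..N} - {j} in
      spectrum_in (positive_cone I)
        (toeplitz_T (int_lattice I) (positive_cone I) (nu j \<tau>' (mu N \<tau> \<phi>)) +
         toeplitz_V (int_lattice I) (positive_cone I) (nu j 0 (mu N 0 \<psi>))))"

definition Omega :: "nat \<Rightarrow> nat \<Rightarrow> nat \<Rightarrow> (nat \<Rightarrow> int) set" where
  "Omega N j n = {y \<in> ordered_cone N. y j - y (j - 1) \<ge> int n}"

end

theory Submission
  imports Defs "HOL-Computational_Algebra.Fundamental_Theorem_Algebra"
begin

text \<open>
  Let \<open>H\<close> be the operator of the theorem. On functions supported where the gap
  \<open>y\<^sub>j - y\<^sub>j\<^sub>-\<^sub>1\<close> is large, a finite-range operator does not notice the constraint
  \<open>y\<^sub>j\<^sub>-\<^sub>1 < y\<^sub>j\<close>. What it sees there is invariant under the translation of all coordinates and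
  under the translation of \<open>y\<^sub>j, \<dots>, y\<^sub>N\<close> against \<open>y\<^sub>1, \<dots>, y\<^sub>j\<^sub>-\<^sub>1\<close>. A Fourier
  transform in these two directions turns it into the family of fibres \<open>H(\<tau>, \<tau>')\<close>, and \<open>\<kappa>\<close>
  vanishes on the spectrum of each fibre. Hence \<open>\<kappa>(H)\<close> is small on such functions.

  The proof replaces \<open>\<kappa>\<close> by a polynomial and the direct integral over the torus by a finite
  average.

  \<^item> The sum \<open>M\<close> of the \<open>\<ell>\<^sup>1\<close> norms of \<open>\<phi>\<close> and \<open>\<psi>\<close> bounds the norms of \<open>H\<close> and of all its fibres.
    Choose a polynomial \<open>p\<close> with \<open>\<bar>p - \<kappa>\<bar> \<le> \<delta>\<close> on \<open>[- M, M]\<close>. Then \<open>\<kappa>(H)\<close> is within \<open>\<delta>\<close> of \<open>p(H)\<close>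
    (\<open>norm_fun_calc_diff_poly_op_le\<close>). Since \<open>\<kappa>\<close> vanishes on the spectrum of each fibre, also
    \<open>\<parallel>p(H(\<tau>, \<tau>'))\<parallel> \<le> \<delta>\<close>. Both estimates rest on \<open>norm_poly_op_le\<close>, the bound of \<open>\<parallel>p(A)\<parallel>\<close> for symmetric
    \<open>A\<close> by the supremum of \<open>\<bar>p\<bar>\<close> over the spectrum of \<open>A\<close>.

  \<^item> Restrict \<open>\<phi>\<close> and \<open>\<psi>\<close> to a finite set \<open>F\<close> of translations (\<open>finite_truncation\<close>). Polynomials are
    Lipschitz in the operator on bounded sets (\<open>poly_op_Lipschitz\<close>), so this changes \<open>p(H)\<close> and all
    the \<open>p(H(\<tau>, \<tau>'))\<close> by at most \<open>\<delta>\<close>. One step of the truncated operator \<open>H\<^sub>F\<close> changes the gap by at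
    most some \<open>r\<close>.

  \<^item> Let \<open>f\<close> be finitely supported where the gap is at least \<open>n\<close>, with \<open>n > r * degree p\<close>. None of
    the powers of \<open>H\<^sub>F\<close> that occur in \<open>p(H\<^sub>F) f\<close> reaches the boundary at gap 0, so the Bloch transform
    carries \<open>p(H\<^sub>F) f\<close> exactly to \<open>p(H\<^sub>F(\<tau>, \<tau>'))\<close> applied to the transform of \<open>f\<close>
    (\<open>Bloch_poly_op_H_trunc\<close>). Only finitely many lattice points are involved, so averaging over the
    grid of points \<open>(m / L, m' / L)\<close> with large \<open>L\<close> satisfies Parseval's identity
    (\<open>Bloch_Parseval\<close>). This gives \<open>\<parallel>p(H\<^sub>F) f\<parallel> \<le> 2 \<delta> \<parallel>f\<parallel>\<close>
    (\<open>norm_poly_op_H_trunc_Omega_le\<close>).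

  \<^item> Finally \<open>\<parallel>\<chi> p(H)\<parallel> \<le> \<parallel>p(H) \<chi>\<parallel>\<close> because \<open>p(H)\<close> and \<open>\<chi>\<close> are symmetric
    (\<open>norm_chi_comp_symmetric_le\<close>). The errors add up to \<open>4 \<delta>\<close>.
\<close>

section \<open>Square-summable functions and symmetric operators\<close>

lemmas comp_add_left = bounded_bilinear.add_left[OF bounded_bilinear_blinfun_compose]
  and comp_add_right = bounded_bilinear.add_right[OF bounded_bilinear_blinfun_compose]
  and comp_diff_left = bounded_bilinear.diff_left[OF bounded_bilinear_blinfun_compose]
  and comp_diff_right = bounded_bilinear.diff_right[OF bounded_bilinear_blinfun_compose]
  and comp_scaleR_left = bounded_bilinear.scaleR_left[OF bounded_bilinear_blinfun_compose]
  and comp_scaleR_right = bounded_bilinear.scaleR_right[OF bounded_bilinear_blinfun_compose]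
  and comp_sum_right = bounded_bilinear.sum_right[OF bounded_bilinear_blinfun_compose]
  and comp_0_left = bounded_bilinear.zero_left[OF bounded_bilinear_blinfun_compose]
  and comp_0_right = bounded_bilinear.zero_right[OF bounded_bilinear_blinfun_compose]

lemma blinfun_compose_assoc: "(A o\<^sub>L B) o\<^sub>L C = A o\<^sub>L (B o\<^sub>L C)"
  by (rule blinfun_eqI) simp

lemma infsum_bounded_linear:
  assumes "bounded_linear h" "f summable_on X"
  shows "(\<Sum>\<^sub>\<infinity>x\<in>X. h (f x)) = h (\<Sum>\<^sub>\<infinity>x\<in>X. f x)"
  using assms infsum_bounded_linear_strong summable_on_bounded_linear by blast

lemma scaleC_ell2_of_real: "scaleC_ell2 (complex_of_real r) f = r *\<^sub>R f"
  by (rule ell2_eqI) (simp add: scaleR_conv_of_real)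

lemma scaleC_ell2_scaleC: "scaleC_ell2 c (scaleC_ell2 d f) = scaleC_ell2 (c * d) f"
  by (rule ell2_eqI) simp

lemma scaleC_ell2_0: "scaleC_ell2 c 0 = 0" "scaleC_ell2 0 f = 0"
  by (rule ell2_eqI, simp)+

lemma ell2_apply_sum: "ell2_apply (\<Sum>i\<in>F. g i) x = (\<Sum>i\<in>F. ell2_apply (g i) x)"
  by (induction F rule: infinite_finite_induct) simp_all

lemma scaleC_ell2_sum: "scaleC_ell2 c (\<Sum>i\<in>F. g i) = (\<Sum>i\<in>F. scaleC_ell2 c (g i))"
  by (rule ell2_eqI) (simp add: ell2_apply_sum sum_distrib_left)

lemma norm_scaleC_ell2: "norm (scaleC_ell2 c f) = cmod c * norm f"
proof -
  have "(norm (scaleC_ell2 c f))\<^sup>2 = (cmod c * norm f)\<^sup>2"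
    by (simp add: norm_ell2_power2 norm_mult power_mult_distrib infsum_cmult_right')
  then show ?thesis
    by (metis abs_norm_cancel abs_mult power2_eq_iff_nonneg norm_ge_zero mult_nonneg_nonneg)
qed

lemma inner_scaleC_ell2: "scaleC_ell2 c f \<bullet> g = f \<bullet> scaleC_ell2 (cnj c) g"
  by (simp add: inner_ell2_def inner_complex_def algebra_simps)

lemma norm_scaleC_op: "norm (c *\<^sub>C A) \<le> cmod c * norm A"
  by (rule norm_blinfun_bound)
    (auto simp: norm_scaleC_ell2 mult.assoc intro!: mult_left_mono norm_blinfun)

lemma bounded_linear_scaleC_op: "bounded_linear (\<lambda>c. c *\<^sub>C A)"
proof (rule bounded_linear_intro[where K = "norm A"])
  show "norm (c *\<^sub>C A) \<le> norm c * norm A" for c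
    by (rule norm_scaleC_op)
qed (auto intro!: blinfun_eqI ell2_eqI simp: blinfun.add_left blinfun.scaleR_left algebra_simps)

lemma scaleC_op_of_real: "complex_of_real r *\<^sub>C A = r *\<^sub>R A"
  by (rule blinfun_eqI) (simp add: scaleC_ell2_of_real blinfun.scaleR_left)

lemma chi_ell2_idem: "chi_ell2 E (chi_ell2 E f) = chi_ell2 E f"
  by (rule ell2_eqI) simp

lemma norm_chi_ell2_le: "norm (chi_ell2 E f) \<le> norm f"
proof (rule norm_ell2_le)
  fix S :: "'a set"
  assume S: "finite S"
  have "(\<Sum>x\<in>S. (cmod (ell2_apply (chi_ell2 E f) x))\<^sup>2) \<le> (\<Sum>x\<in>S. (cmod (ell2_apply f x))\<^sup>2)"
    by (rule sum_mono) simp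
  then show "(\<Sum>x\<in>S. (cmod (ell2_apply (chi_ell2 E f) x))\<^sup>2) \<le> (norm f)\<^sup>2"
    using sum_le_norm_ell2_power2[OF S, of f] by linarith
qed simp

lemma norm_chi_le: "norm (chi E) \<le> 1"
  by (rule norm_blinfun_bound) (auto intro: norm_chi_ell2_le)

lemma chi_comp_chi: "chi E o\<^sub>L chi E = chi E"
  by (rule blinfun_eqI) (simp add: chi_ell2_idem)

lemma inner_chi_ell2: "chi_ell2 E f \<bullet> g = f \<bullet> chi_ell2 E g"
  unfolding inner_ell2_def by (rule infsum_cong) simp

lemma scaleC_chi_ell2: "scaleC_ell2 c (chi_ell2 E f) = chi_ell2 E (scaleC_ell2 c f)"
  by (rule ell2_eqI) simp

text \<open>The error is the tail of a convergent sum, so finitely supported functions are dense.\<close>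

lemma chi_finite_approx:
  fixes f :: "'a ell2"
  assumes "e > 0"
  obtains S where "finite S" "norm (f - chi_ell2 S f) < e"
proof -
  let ?w = "\<lambda>x. (cmod (ell2_apply f x))\<^sup>2"
  obtain S where S: "finite S" "dist (sum ?w S) (infsum ?w UNIV) < e\<^sup>2"
    using has_sum_infsum[OF ell2_summable[of f]] assms
    unfolding has_sum_def tendsto_iff eventually_finite_subsets_at_top
    by (meson order_refl subset_UNIV zero_less_power)
  have "(norm (f - chi_ell2 S f))\<^sup>2 = (\<Sum>\<^sub>\<infinity>x\<in>UNIV - S. ?w x)"
    unfolding norm_ell2_power2 by (rule infsum_cong_neutral) auto
  also have "\<dots> = infsum ?w UNIV - sum ?w S"
    using S(1) by (subst infsum_Diff) (auto intro: ell2_summable)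
  finally have "(norm (f - chi_ell2 S f))\<^sup>2 < e\<^sup>2"
    using S(2) by (simp add: dist_real_def)
  then show ?thesis
    using that[OF S(1)] assms by (meson less_imp_le power_less_imp_less_base)
qed

text \<open>Density argument: a bound for an operator may be checked on finitely supported functions, which
  is where the finite average in the Parseval identity is available.\<close>

lemma norm_apply_le_of_finite:
  assumes "\<And>S. finite S \<Longrightarrow> norm (blinfun_apply A (chi_ell2 S f)) \<le> c"
  shows "norm (blinfun_apply A f) \<le> c"
proof (rule field_le_epsilon)
  fix e :: real assume "e > 0"
  have pos: "norm A + 1 > 0"
    by (simp add: add_nonneg_pos)
  then obtain S where S: "finite S" "norm (f - chi_ell2 S f) < e / (norm A + 1)"
    using chi_finite_approx \<open>e > 0\<close> by (metis divide_pos_pos)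
  have "norm (A (f - chi_ell2 S f)) \<le> norm A * norm (f - chi_ell2 S f)"
    by (rule norm_blinfun)
  also have "\<dots> \<le> (norm A + 1) * norm (f - chi_ell2 S f)"
    by (simp add: distrib_right)
  also have "\<dots> \<le> e"
    using S(2) pos by (simp add: field_simps)
  finally have "norm (A f - A (chi_ell2 S f)) \<le> e"
    by (simp add: blinfun.diff_right)
  then show "norm (A f) \<le> c + e"
    using assms[OF S(1)] norm_triangle_sub[of "A f" "A (chi_ell2 S f)"] by linarith
qed

text \<open>Symmetry for the real inner product, that is for the real part of \<^const>\<open>cinner\<close>. The estimates
  below concern norms and real polynomials, for which this form suffices.\<close>

definition symmetric_op :: "'a ell2_op \<Rightarrow> bool" where
  "symmetric_op A \<longleftrightarrow> (\<forall>f g. blinfun_apply A f \<bullet> g = f \<bullet> blinfun_apply A g)"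

lemma symmetric_opD: "symmetric_op A \<Longrightarrow> blinfun_apply A f \<bullet> g = f \<bullet> blinfun_apply A g"
  by (simp add: symmetric_op_def)

lemma symmetric_chi: "symmetric_op (chi E)"
  by (simp add: symmetric_op_def inner_chi_ell2)

lemma symmetric_add: "symmetric_op A \<Longrightarrow> symmetric_op B \<Longrightarrow> symmetric_op (A + B)"
  by (simp add: symmetric_op_def blinfun.add_left inner_add_left inner_add_right)

lemma symmetric_scaleR: "symmetric_op A \<Longrightarrow> symmetric_op (r *\<^sub>R A)"
  by (simp add: symmetric_op_def blinfun.scaleR_left)

lemma symmetric_comp:
  "symmetric_op A \<Longrightarrow> symmetric_op B \<Longrightarrow> A o\<^sub>L B = B o\<^sub>L A \<Longrightarrow> symmetric_op (A o\<^sub>L B)"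
  by (metis blinfun_apply_blinfun_compose symmetric_op_def)

text \<open>Expanding the square, the mixed term is \<open>- 2 b\<^sup>2 \<parallel>B x\<parallel>\<^sup>2\<close> by symmetry. With \<open>b = \<parallel>B\<parallel>\<close> the right-hand
  side is at most \<open>b\<^sup>2 (b\<^sup>2 \<parallel>x\<parallel>\<^sup>2 - \<parallel>B x\<parallel>\<^sup>2)\<close>. A lower bound for the left-hand side therefore keeps
  \<open>\<parallel>B x\<parallel>\<close> away from \<open>b \<parallel>x\<parallel>\<close>.\<close>

lemma symmetric_op_norm_sq_le:
  assumes "symmetric_op B"
  shows "(norm (b\<^sup>2 *\<^sub>R x - B (B x)))\<^sup>2 \<le>
    b^4 * (norm x)\<^sup>2 - 2 * b\<^sup>2 * (norm (B x))\<^sup>2 + (norm (B (B x)))\<^sup>2"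
proof -
  have "x \<bullet> B (B x) = (norm (B x))\<^sup>2"
    using symmetric_opD[OF assms, of x "B x"] by (simp add: power2_norm_eq_inner)
  then show ?thesis
    unfolding power2_norm_eq_inner
    by (simp add: inner_diff_left inner_diff_right inner_commute algebra_simps power2_eq_square
        power4_eq_xxxx)
qed

text \<open>The two products are adjoint to each other. With \<open>y = \<chi> P f\<close> one has
  \<open>\<parallel>y\<parallel>\<^sup>2 = \<langle>y, P f\<rangle> = \<langle>P \<chi> y, f\<rangle>\<close>, and Cauchy--Schwarz gives the bound.\<close>

lemma norm_chi_comp_symmetric_le:
  assumes "symmetric_op P"
  shows "norm (chi G o\<^sub>L P) \<le> norm (P o\<^sub>L chi G)"
proof (rule norm_blinfun_bound)
  fix f
  define y where "y = chi_ell2 G (P f)"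
  have "(norm y)\<^sup>2 = y \<bullet> P f"
    by (metis y_def chi_ell2_idem inner_chi_ell2 power2_norm_eq_inner)
  also have "\<dots> = (P o\<^sub>L chi G) y \<bullet> f"
    using symmetric_opD[OF assms, of y f] by (simp add: y_def chi_ell2_idem)
  also have "\<dots> \<le> norm ((P o\<^sub>L chi G) y) * norm f"
    by (rule norm_cauchy_schwarz)
  also have "\<dots> \<le> norm (P o\<^sub>L chi G) * norm y * norm f"
    by (intro mult_right_mono norm_blinfun) simp
  finally have "norm y * norm y \<le> norm y * (norm (P o\<^sub>L chi G) * norm f)"
    by (simp add: power2_eq_square mult_ac)
  then have "norm y \<le> norm (P o\<^sub>L chi G) * norm f"
    by (cases "norm y = 0") auto
  then show "norm ((chi G o\<^sub>L P) f) \<le> norm (P o\<^sub>L chi G) * norm f"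
    by (simp add: y_def)
qed simp

text \<open>Summability is what lets the real part of \<^const>\<open>cinner\<close> be taken term by term.\<close>

lemma cinner_summable: "(\<lambda>x. cnj (ell2_apply f x) * ell2_apply g x) summable_on UNIV"
proof (rule abs_summable_summable)
  have "(\<lambda>x. (cmod (ell2_apply f x))\<^sup>2 + (cmod (ell2_apply g x))\<^sup>2) summable_on UNIV"
    by (intro summable_on_add ell2_summable)
  then show "(\<lambda>x. norm (cnj (ell2_apply f x) * ell2_apply g x)) summable_on UNIV"
  proof (rule Infinite_Sum.abs_summable_on_comparison_test')
    fix x
    show "norm (cnj (ell2_apply f x) * ell2_apply g x)
      \<le> (cmod (ell2_apply f x))\<^sup>2 + (cmod (ell2_apply g x))\<^sup>2"
      using sum_squares_bound[of "cmod (ell2_apply f x)" "cmod (ell2_apply g x)"]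
        mult_nonneg_nonneg[OF norm_ge_zero[of "ell2_apply f x"] norm_ge_zero[of "ell2_apply g x"]]
      unfolding norm_mult complex_mod_cnj by linarith
  qed
qed

lemma Re_cinner: "Re (cinner f g) = f \<bullet> g"
proof -
  have "Re (cinner f g) = (\<Sum>\<^sub>\<infinity>x. Re (cnj (ell2_apply f x) * ell2_apply g x))"
    unfolding cinner_def
    by (rule infsum_bounded_linear[OF bounded_linear_Re cinner_summable, symmetric])
  then show ?thesis
    by (simp add: inner_ell2_def inner_complex_def)
qed

lemma selfadjoint_imp_symmetric_op: "selfadjoint A \<Longrightarrow> symmetric_op A"
  unfolding selfadjoint_def symmetric_op_def by (metis Re_cinner)

section \<open>Polynomials of an operator\<close>

lemma poly_op_apply: "poly_op G p A f =
    (\<Sum>i\<le>degree p. coeff p i *\<^sub>R (((\<lambda>B. A o\<^sub>L B) ^^ i) (chi G) f))"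
  by (simp add: poly_op_def blinfun.sum_left blinfun.scaleR_left)

text \<open>An operator living on the functions supported in \<open>E\<close>, extended by zero; \<^term>\<open>chi E\<close> is the unit
  for composition with it.\<close>

locale operator_on =
  fixes E :: "'a set" and A :: "'a ell2_op"
  assumes compressed: "A = chi E o\<^sub>L A o\<^sub>L chi E"
begin

lemma chi_comp_left: "chi E o\<^sub>L A = A" and chi_comp_right: "A o\<^sub>L chi E = A"
  using compressed chi_comp_chi by (metis blinfun_compose_assoc)+

lemma poly_op_eq_sum:
  assumes "degree p \<le> n"
  shows "poly_op E p A = (\<Sum>i\<le>n. coeff p i *\<^sub>R ((\<lambda>B. A o\<^sub>L B) ^^ i) (chi E))"
  unfolding poly_op_def
  by (rule sum.mono_neutral_left) (use assms in \<open>auto simp: coeff_eq_0\<close>)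

lemma poly_op_0: "poly_op E 0 A = 0"
  by (simp add: poly_op_def)

text \<open>This Horner step makes induction over \<^const>\<open>pCons\<close> available, so that \<open>p \<mapsto> p(A)\<close> is shown to be
  multiplicative without manipulating double sums of coefficients.\<close>

lemma poly_op_pCons: "poly_op E (pCons a p) A = a *\<^sub>R chi E + (A o\<^sub>L poly_op E p A)"
proof -
  have "poly_op E (pCons a p) A
      = (\<Sum>i\<le>Suc (degree p). coeff (pCons a p) i *\<^sub>R ((\<lambda>B. A o\<^sub>L B) ^^ i) (chi E))"
    by (rule poly_op_eq_sum) (simp add: degree_pCons_le)
  also have "\<dots> = a *\<^sub>R chi E + (\<Sum>i\<le>degree p. coeff p i *\<^sub>R (A o\<^sub>L ((\<lambda>B. A o\<^sub>L B) ^^ i) (chi E)))"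
    by (subst sum.atMost_Suc_shift) (simp add: coeff_pCons)
  also have "(\<Sum>i\<le>degree p. coeff p i *\<^sub>R (A o\<^sub>L ((\<lambda>B. A o\<^sub>L B) ^^ i) (chi E)))
      = A o\<^sub>L poly_op E p A"
    unfolding poly_op_def
    by (simp add: comp_sum_right comp_scaleR_right)
  finally show ?thesis .
qed

lemma poly_op_add: "poly_op E (p + q) A = poly_op E p A + poly_op E q A"
proof -
  define n where "n = max (degree p) (degree q)"
  have "degree (p + q) \<le> n" "degree p \<le> n" "degree q \<le> n"
    by (auto simp: n_def degree_add_le)
  then show ?thesis
    by (simp add: poly_op_eq_sum[where n = n] scaleR_add_left sum.distrib)
qed

lemma poly_op_smult: "poly_op E (smult a p) A = a *\<^sub>R poly_op E p A"
  using degree_smult_le[of a p]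
  by (simp add: poly_op_eq_sum[where n = "degree p"] scaleR_sum_right)

lemma poly_op_diff: "poly_op E (p - q) A = poly_op E p A - poly_op E q A"
  using poly_op_add[of "p - q" q] by simp

lemma poly_op_chi_left: "chi E o\<^sub>L poly_op E p A = poly_op E p A"
  by (induction p) (simp_all add: poly_op_0 comp_0_right poly_op_pCons comp_add_right
      comp_scaleR_right chi_comp_chi chi_comp_left flip: blinfun_compose_assoc)

lemma poly_op_chi_right: "poly_op E p A o\<^sub>L chi E = poly_op E p A"
  by (induction p) (simp_all add: poly_op_0 comp_0_left poly_op_pCons comp_add_left
      comp_scaleR_left chi_comp_chi blinfun_compose_assoc)

lemma poly_op_commute: "A o\<^sub>L poly_op E p A = poly_op E p A o\<^sub>L A"
proof (induction p)
  case (pCons a p)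
  have "A o\<^sub>L poly_op E (pCons a p) A = a *\<^sub>R A + (A o\<^sub>L (A o\<^sub>L poly_op E p A))"
    by (simp add: poly_op_pCons comp_add_right comp_scaleR_right chi_comp_right)
  also have "\<dots> = poly_op E (pCons a p) A o\<^sub>L A"
    by (simp add: pCons poly_op_pCons comp_add_left comp_scaleR_left chi_comp_left
        flip: blinfun_compose_assoc)
  finally show ?case .
qed (simp add: poly_op_0 comp_0_left comp_0_right)

lemma poly_op_mult: "poly_op E (p * q) A = poly_op E p A o\<^sub>L poly_op E q A"
  by (induction p) (simp_all add: poly_op_0 comp_0_left mult_pCons_left poly_op_add poly_op_smult
      poly_op_pCons comp_add_left comp_scaleR_left blinfun_compose_assoc poly_op_chi_left)

lemma poly_op_const: "poly_op E [:a:] A = a *\<^sub>R chi E"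
  by (simp add: poly_op_pCons poly_op_0 comp_0_right)

lemma poly_op_linear: "poly_op E [:a, b:] A = a *\<^sub>R chi E + b *\<^sub>R A"
  by (simp add: poly_op_pCons poly_op_0 comp_0_right comp_scaleR_right chi_comp_right)

lemma symmetric_poly_op:
  assumes "symmetric_op A"
  shows "symmetric_op (poly_op E p A)"
proof (induction p)
  case 0
  then show ?case by (simp add: poly_op_0 symmetric_op_def)
next
  case (pCons a p)
  then show ?case
    unfolding poly_op_pCons
    by (intro symmetric_add symmetric_scaleR symmetric_chi symmetric_comp assms poly_op_commute)
qed

text \<open>Off the spectrum there is a bounded left inverse \<open>B\<close>, and \<open>\<parallel>x\<parallel> \<le> \<parallel>B\<parallel> \<parallel>(A - t) x\<parallel>\<close>.\<close>

lemma bounded_below_of_not_spectrum: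
  assumes "complex_of_real t \<notin> spectrum_in E A"
  obtains m where "m > 0" "\<And>x. m * norm (chi_ell2 E x) \<le> norm (poly_op E [:- t, 1:] A x)"
proof -
  obtain B where B: "B o\<^sub>L (A - complex_of_real t *\<^sub>C chi E) = chi E"
    using assms by (auto simp: spectrum_in_def)
  have eq: "poly_op E [:- t, 1:] A = A - complex_of_real t *\<^sub>C chi E"
    by (simp add: poly_op_linear scaleC_op_of_real)
  have le: "norm (chi_ell2 E x) \<le> norm B * norm (poly_op E [:- t, 1:] A x)" for x
    using norm_blinfun[of B "poly_op E [:- t, 1:] A x"] B unfolding eq
    by (metis blinfun_apply_blinfun_compose chi_apply)
  show ?thesis
  proof (rule that[of "1 / (norm B + 1)"])
    fix x
    have "norm (chi_ell2 E x) \<le> (norm B + 1) * norm (poly_op E [:- t, 1:] A x)"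
      using le[of x] norm_ge_zero[of "poly_op E [:- t, 1:] A x"]
      unfolding distrib_right by linarith
    then show "1 / (norm B + 1) * norm (chi_ell2 E x) \<le> norm (poly_op E [:- t, 1:] A x)"
      by (simp add: divide_simps mult.commute add_nonneg_pos)
  qed (simp add: add_nonneg_pos)
qed

text \<open>The polynomial is \<open>(X - a)\<^sup>2 + b\<^sup>2\<close>. By symmetry the form \<open>\<langle>((A - a)\<^sup>2 + b\<^sup>2) y, y\<rangle>\<close> equals
  \<open>\<parallel>(A - a) y\<parallel>\<^sup>2 + b\<^sup>2 \<parallel>y\<parallel>\<^sup>2\<close>, hence is at least \<open>b\<^sup>2 \<parallel>y\<parallel>\<^sup>2\<close>. In spectral terms,
  \<open>a \<plusminus> b \<i>\<close> with \<open>b \<noteq> 0\<close> is not an approximate eigenvalue of a symmetric operator.\<close>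

lemma bounded_below_quadratic:
  assumes "symmetric_op A"
  shows "b\<^sup>2 * norm (chi_ell2 E x) \<le> norm (poly_op E [:a\<^sup>2 + b\<^sup>2, - 2 * a, 1:] A x)"
proof -
  define L where "L = poly_op E [:- a, 1:] A"
  define Q where "Q = poly_op E [:a\<^sup>2 + b\<^sup>2, - 2 * a, 1:] A"
  define y where "y = chi_ell2 E x"
  have "[:a\<^sup>2 + b\<^sup>2, - 2 * a, 1:] = [:- a, 1:] * [:- a, 1:] + [:b\<^sup>2:]"
    by (simp add: power2_eq_square)
  then have Q: "Q = (L o\<^sub>L L) + b\<^sup>2 *\<^sub>R chi E"
    unfolding Q_def L_def by (simp only: poly_op_add poly_op_mult poly_op_const)
  have "Q x = Q y"
    unfolding Q_def y_def by (metis poly_op_chi_right blinfun_apply_blinfun_compose chi_apply)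
  have "Q y \<bullet> y = (norm (L y))\<^sup>2 + b\<^sup>2 * (norm y)\<^sup>2"
    using symmetric_opD[OF symmetric_poly_op[OF assms], of "[:- a, 1:]" "L y" y]
    by (simp add: Q blinfun.add_left blinfun.scaleR_left inner_add_left power2_norm_eq_inner
        y_def chi_ell2_idem L_def)
  then have "b\<^sup>2 * (norm y)\<^sup>2 \<le> norm (Q y) * norm y"
    using norm_cauchy_schwarz[of "Q y" y] by (smt (verit) zero_le_power2)
  then have "b\<^sup>2 * norm y \<le> norm (Q y)"
    by (cases "norm y = 0") (simp_all add: power2_eq_square flip: mult.assoc)
  then show ?thesis
    using \<open>Q x = Q y\<close> by (simp add: Q_def y_def)
qed

end

lemma map_poly_of_real_add:
  "map_poly complex_of_real (p + q) = map_poly complex_of_real p + map_poly complex_of_real q"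
  by (rule poly_eqI) (simp add: coeff_map_poly)

lemma map_poly_of_real_mult:
  "map_poly complex_of_real (p * q) = map_poly complex_of_real p * map_poly complex_of_real q"
  by (rule poly_eqI) (simp add: coeff_map_poly coeff_mult)

text \<open>A complex root exists by the fundamental theorem of algebra. If it is real, it gives a linear
  factor. If it is \<open>a + b \<i>\<close> with \<open>b \<noteq> 0\<close>, the remainder of \<open>q\<close> modulo \<open>(X - a)\<^sup>2 + b\<^sup>2\<close> is a real
  polynomial of degree at most one that vanishes at a nonreal point, hence is zero.\<close>

lemma real_poly_has_factor:
  fixes q :: "real poly"
  assumes "degree q \<noteq> 0"
  obtains (linear) t r where "q = [:- t, 1:] * r"
    | (quadratic) a b r where "b \<noteq> 0" "q = [:a\<^sup>2 + b\<^sup>2, - 2 * a, 1:] * r"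
proof -
  have "\<not> constant (poly (map_poly complex_of_real q))"
    using assms by (simp add: constant_degree degree_map_poly)
  then obtain z where z: "poly (map_poly complex_of_real q) z = 0"
    using fundamental_theorem_of_algebra by blast
  define a b where "a = Re z" and "b = Im z"
  have z_eq: "z = Complex a b"
    by (simp add: a_def b_def)
  show ?thesis
  proof (cases "b = 0")
    case True
    then have "poly (map_poly complex_of_real q) (complex_of_real a) = 0"
      using z z_eq by (simp add: complex_eq_iff complex_of_real_def)
    moreover have "poly (map_poly complex_of_real p) (complex_of_real t) = complex_of_real (poly p t)"
      for p t
      by (induction p) (simp_all add: map_poly_pCons)
    ultimately have "poly q a = 0"
      by simp
    then show ?thesis
      using linear by (metis dvdE poly_eq_0_iff_dvd)
  next
    case False
    define d where "d = [:a\<^sup>2 + b\<^sup>2, - 2 * a, 1:]"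
    have "poly (map_poly complex_of_real d) z = 0"
      by (simp add: d_def map_poly_pCons z_eq complex_eq_iff power2_eq_square algebra_simps)
    moreover have "q = d * (q div d) + q mod d"
      by simp
    then have "poly (map_poly complex_of_real q) z =
        poly (map_poly complex_of_real d) z * poly (map_poly complex_of_real (q div d)) z
        + poly (map_poly complex_of_real (q mod d)) z"
      by (metis map_poly_of_real_add map_poly_of_real_mult poly_add poly_mult)
    ultimately have mod0: "poly (map_poly complex_of_real (q mod d)) z = 0"
      using z by simp
    have "degree d = 2" "d \<noteq> 0"
      by (simp_all add: d_def)
    then have "degree (q mod d) \<le> 1"
      using degree_mod_less[of d q] by auto
    then have "q mod d = [:coeff (q mod d) 0, coeff (q mod d) 1:]"
      by (intro poly_eqI) (auto simp: coeff_pCons coeff_eq_0 split: nat.split)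
    then obtain u v where uv: "q mod d = [:u, v:]"
      by blast
    have "v = 0" "u = 0"
      using mod0 False by (auto simp: uv map_poly_pCons z_eq complex_eq_iff)
    then have "q = d * (q div d)"
      using uv \<open>q = d * (q div d) + q mod d\<close> by simp
    then show ?thesis
      using quadratic[OF False] d_def by blast
  qed
qed

context operator_on
begin

text \<open>The half of the spectral mapping theorem that is needed: by induction on the degree, split off real
  linear and quadratic factors. Linear factors have their root off the spectrum, quadratic factors
  without real roots are bounded below by symmetry, and lower bounds multiply.\<close>

lemma poly_op_bounded_below:
  assumes "symmetric_op A" "q \<noteq> 0"
    and "\<And>t. complex_of_real t \<in> spectrum_in E A \<Longrightarrow> poly q t \<noteq> 0"
  shows "\<exists>m>0. \<forall>x. m * norm (chi_ell2 E x) \<le> norm (poly_op E q A x)"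
  using assms(2,3)
proof (induction "degree q" arbitrary: q rule: less_induct)
  case less
  have factor: "\<exists>m>0. \<forall>x. m * norm (chi_ell2 E x) \<le> norm (poly_op E q A x)"
    if q: "q = d * r" and deg: "degree d \<noteq> 0"
      and c: "c > 0" "\<And>x. c * norm (chi_ell2 E x) \<le> norm (poly_op E d A x)" for d r c
  proof -
    have "degree r < degree q"
      using deg less.prems(1) by (simp add: q degree_mult_eq)
    then obtain m where m: "m > 0" "\<And>x. m * norm (chi_ell2 E x) \<le> norm (poly_op E r A x)"
      using less.hyps[of r] less.prems by (auto simp: q)
    have "c * m * norm (chi_ell2 E x) \<le> norm (poly_op E q A x)" for x
    proof -
      have "c * (m * norm (chi_ell2 E x)) \<le> c * norm (poly_op E r A x)"
        using m(2)[of x] c(1) by simp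
      also have "poly_op E r A x = chi_ell2 E (poly_op E r A x)"
        by (metis poly_op_chi_left blinfun_apply_blinfun_compose chi_apply)
      also have "c * norm \<dots> \<le> norm (poly_op E d A (poly_op E r A x))"
        by (rule c(2))
      finally show ?thesis
        by (simp add: q poly_op_mult mult.assoc)
    qed
    then show ?thesis
      using c(1) m(1) by (intro exI[of _ "c * m"]) simp
  qed
  show ?case
  proof (cases "degree q = 0")
    case True
    then obtain a where "q = [:a:]"
      by (metis degree_eq_zeroE)
    then show ?thesis
      using less.prems(1)
      by (intro exI[of _ "\<bar>a\<bar>"]) (simp add: poly_op_const blinfun.scaleR_left)
  next
    case False
    then show ?thesis
    proof (cases rule: real_poly_has_factor)
      case (linear t r)
      then have "complex_of_real t \<notin> spectrum_in E A"
        using less.prems(2)[of t] by auto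
      then obtain c where "c > 0" "\<And>x. c * norm (chi_ell2 E x) \<le> norm (poly_op E [:- t, 1:] A x)"
        using bounded_below_of_not_spectrum by blast
      then show ?thesis
        using factor[OF linear] by simp
    next
      case (quadratic a b r)
      then show ?thesis
        using factor[OF quadratic(2), of "b\<^sup>2"] bounded_below_quadratic[OF assms(1)] by simp
    qed
  qed
qed

text \<open>Suppose \<open>b = \<parallel>p(A)\<parallel>\<close> exceeds \<open>c\<close>. Then \<open>q = b\<^sup>2 - p\<^sup>2\<close> has no zero on the spectrum, so \<open>q(A)\<close> is bounded
  below. But \<open>\<parallel>B x\<parallel> / \<parallel>x\<parallel>\<close> comes arbitrarily close to \<open>b\<close> for \<open>B = p(A)\<close>, and for such \<open>x\<close> the vector
  \<open>(b\<^sup>2 - B\<^sup>2) x\<close> is arbitrarily small relative to \<open>x\<close>. For nonconstant \<open>p\<close> the polynomial \<open>q\<close> is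
  certainly nonzero.\<close>

lemma norm_poly_op_le_nonconstant:
  assumes sym: "symmetric_op A"
    and le: "\<And>t. complex_of_real t \<in> spectrum_in E A \<Longrightarrow> \<bar>poly p t\<bar> \<le> c" "0 \<le> c"
    and deg: "degree p \<noteq> 0"
  shows "norm (poly_op E p A) \<le> c"
proof (rule ccontr)
  define B where "B = poly_op E p A"
  define b where "b = norm B"
  assume "\<not> norm (poly_op E p A) \<le> c"
  then have "c < b"
    by (simp add: b_def B_def)
  with le(2) have b: "b > 0" by simp
  \<comment> \<open>vanishes exactly where \<open>\<bar>p\<bar> = b\<close>, hence nowhere on the spectrum\<close>
  define q where "q = [:b\<^sup>2:] - p * p"
  have "q \<noteq> 0"
  proof
    assume "q = 0"
    then have "p * p = [:b\<^sup>2:]"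
      by (simp add: q_def)
    then have "degree (p * p) = 0"
      by simp
    moreover have "degree (p * p) = degree p + degree p"
      using deg by (intro degree_mult_eq) auto
    ultimately show False
      using deg by simp
  qed
  moreover have "poly q t \<noteq> 0" if "complex_of_real t \<in> spectrum_in E A" for t
  proof -
    have "\<bar>poly p t\<bar> < \<bar>b\<bar>"
      using le(1)[OF that] \<open>c < b\<close> by simp
    then have "(poly p t)\<^sup>2 < b\<^sup>2"
      by (metis abs_ge_zero pos2 power2_abs power_strict_mono)
    then show ?thesis
      by (simp add: q_def power2_eq_square)
  qed
  ultimately obtain m where m: "m > 0" "\<And>x. m * norm (chi_ell2 E x) \<le> norm (poly_op E q A x)"
    using poly_op_bounded_below[OF sym] by blast
  have q_op: "poly_op E q A = b\<^sup>2 *\<^sub>R chi E - (B o\<^sub>L B)"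
    by (simp add: q_def B_def poly_op_diff poly_op_mult poly_op_const)
  have symB: "symmetric_op B"
    unfolding B_def by (rule symmetric_poly_op[OF sym])
  have B_chi: "B x = B (chi_ell2 E x)" for x
    unfolding B_def by (metis poly_op_chi_right blinfun_apply_blinfun_compose chi_apply)
  \<comment> \<open>a bound for \<open>\<parallel>B x\<parallel>\<close> with a constant strictly below \<open>b = \<parallel>B\<parallel>\<close>\<close>
  have est: "b\<^sup>2 * (norm (B x))\<^sup>2 \<le> (b^4 - m\<^sup>2) * (norm (chi_ell2 E x))\<^sup>2" for x
  proof -
    define y where "y = chi_ell2 E x"
    have "chi_ell2 E y = y"
      by (simp add: y_def chi_ell2_idem)
    then have "m * norm y \<le> norm (b\<^sup>2 *\<^sub>R y - B (B y))"
      using m(2)[of y] by (simp add: q_op blinfun.diff_left blinfun.scaleR_left)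
    then have "(m * norm y)\<^sup>2 \<le> (norm (b\<^sup>2 *\<^sub>R y - B (B y)))\<^sup>2"
      using m(1) by (intro power_mono) auto
    also have "\<dots> \<le> b^4 * (norm y)\<^sup>2 - 2 * b\<^sup>2 * (norm (B y))\<^sup>2 + (norm (B (B y)))\<^sup>2"
      by (rule symmetric_op_norm_sq_le[OF symB])
    also have "(norm (B (B y)))\<^sup>2 \<le> (b * norm (B y))\<^sup>2"
      unfolding b_def by (intro power_mono norm_blinfun) auto
    finally have "b\<^sup>2 * (norm (B y))\<^sup>2 \<le> (b^4 - m\<^sup>2) * (norm y)\<^sup>2"
      by (simp add: power_mult_distrib algebra_simps)
    then show ?thesis
      using B_chi[of x] by (simp add: y_def)
  qed
  show False
  proof (cases "b^4 - m\<^sup>2 \<le> 0")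
    case True
    have "B x = 0" for x
    proof -
      have "b\<^sup>2 * (norm (B x))\<^sup>2 \<le> 0"
        using est[of x] True by (smt (verit) mult_nonpos_nonneg zero_le_power2)
      then show ?thesis
        using b by (simp add: mult_le_0_iff)
    qed
    then have "B = 0"
      by (intro blinfun_eqI) simp
    then show False
      using b by (simp add: b_def)
  next
    case False
    define s where "s = sqrt ((b^4 - m\<^sup>2) / b\<^sup>2)"
    have s2: "s\<^sup>2 = (b^4 - m\<^sup>2) / b\<^sup>2"
      using False by (simp add: s_def)
    have "norm (B x) \<le> s * norm x" for x
    proof (rule power2_le_imp_le)
      have "b\<^sup>2 * (norm (B x))\<^sup>2 \<le> (b^4 - m\<^sup>2) * (norm x)\<^sup>2"
        using est[of x] False norm_chi_ell2_le[of E x]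
        by (smt (verit) mult_left_mono norm_ge_zero power_mono)
      then show "(norm (B x))\<^sup>2 \<le> (s * norm x)\<^sup>2"
        using b by (simp add: power_mult_distrib s2 field_simps)
    qed (use False in \<open>simp add: s_def\<close>)
    then have "b \<le> s"
      unfolding b_def using False by (intro norm_blinfun_bound) (auto simp: s_def)
    then have "b\<^sup>2 \<le> s\<^sup>2"
      using b by (intro power_mono) auto
    then have "b\<^sup>2 * b\<^sup>2 \<le> b^4 - m\<^sup>2"
      using b by (simp add: s2 field_simps)
    then show False
      using mult_pos_pos[OF m(1) m(1)] by (simp add: power2_eq_square power4_eq_xxxx)
  qed
qed

text \<open>This bound makes the functional calculus well defined and turns the hypothesis on the fibre spectra
  into a norm estimate. For constant \<open>p\<close> the claim amounts to the spectrum having a real point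
  unless \<open>E\<close> is empty.\<close>

theorem norm_poly_op_le:
  assumes sym: "symmetric_op A"
    and le: "\<And>t. complex_of_real t \<in> spectrum_in E A \<Longrightarrow> \<bar>poly p t\<bar> \<le> c" "0 \<le> c"
  shows "norm (poly_op E p A) \<le> c"
proof (cases "degree p = 0")
  case False
  then show ?thesis
    using norm_poly_op_le_nonconstant assms by blast
next
  case True
  then obtain a where p: "p = [:a:]"
    by (metis degree_eq_zeroE)
  show ?thesis
  proof (cases "\<exists>t. complex_of_real t \<in> spectrum_in E A")
    case True
    then have "\<bar>a\<bar> \<le> c"
      using le by (auto simp: p)
    moreover have "\<bar>a\<bar> * norm (chi E) \<le> \<bar>a\<bar> * 1"
      by (intro mult_left_mono norm_chi_le) auto
    ultimately show ?thesis
      by (simp add: p poly_op_const)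
  next
    case False
    \<comment> \<open>With empty real spectrum, the polynomial \<open>X\<close> forces \<open>A = 0\<close>; as 0 is not in the spectrum,
      the unit \<^term>\<open>chi E\<close> must then vanish.\<close>
    have "norm (poly_op E [:0, 1:] A) \<le> 0"
      by (rule norm_poly_op_le_nonconstant[OF sym]) (use False in auto)
    then have "A = 0"
      by (simp add: poly_op_linear)
    have "\<exists>B. bounded_op_in E B \<and> (A - complex_of_real 0 *\<^sub>C chi E) o\<^sub>L B = chi E"
      using False by (simp only: spectrum_in_def) blast
    then have "chi E = 0"
      using \<open>A = 0\<close> by (auto simp: scaleC_op_of_real comp_0_left simp del: of_real_0)
    then show ?thesis
      using le(2) by (simp add: p poly_op_const)
  qed
qed

text \<open>The resolvent is minus the Neumann series \<open>\<Sum>n. t\<^sup>-\<^sup>n\<^sup>-\<^sup>1 A\<^sup>n\<close>, summed with the unit \<^term>\<open>chi E\<close> as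
  zeroth power. Hence the real points of the spectrum lie in \<open>[- \<parallel>A\<parallel>, \<parallel>A\<parallel>]\<close>, where Weierstrass
  approximation applies.\<close>

lemma Neumann_resolvent:
  assumes lin: "\<And>c f. blinfun_apply A (scaleC_ell2 c f) = scaleC_ell2 c (blinfun_apply A f)"
    and t: "norm A < \<bar>t\<bar>"
  shows "complex_of_real t \<notin> spectrum_in E A"
proof -
  define P where "P = (\<lambda>n. ((\<lambda>B. A o\<^sub>L B) ^^ n) (chi E))"
  have P_Suc: "P (Suc n) = A o\<^sub>L P n" and P_0: "P 0 = chi E" for n
    by (simp_all add: P_def)
  have P_chi: "chi E o\<^sub>L P n = P n" "P n o\<^sub>L chi E = P n" "P n o\<^sub>L A = P (Suc n)" for n
  proof -
    show "chi E o\<^sub>L P n = P n"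
      by (induction n) (simp_all add: P_Suc P_0 chi_comp_chi chi_comp_left flip: blinfun_compose_assoc)
    show "P n o\<^sub>L chi E = P n"
      by (induction n) (simp_all add: P_Suc P_0 chi_comp_chi blinfun_compose_assoc)
    show "P n o\<^sub>L A = P (Suc n)"
      by (induction n) (simp_all add: P_Suc P_0 chi_comp_left chi_comp_right blinfun_compose_assoc)
  qed
  have P_lin: "P n (scaleC_ell2 c f) = scaleC_ell2 c (P n f)" for n c f
    by (induction n) (simp_all add: P_Suc P_0 scaleC_chi_ell2 lin)
  have norm_P: "norm (P n) \<le> norm A ^ n" for n
  proof (induction n)
    case (Suc n)
    then show ?case
      unfolding P_Suc power_Suc using norm_blinfun_compose[of A "P n"]
      by (meson mult_left_mono norm_ge_zero order_trans)
  qed (simp add: P_0 norm_chi_le)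
  have t0: "t \<noteq> 0"
    using t norm_ge_zero[of A] by auto
  define G where "G = (\<lambda>n. inverse t ^ Suc n *\<^sub>R P n)"
  have sumG: "summable G"
  proof (rule summable_comparison_test)
    show "\<exists>N. \<forall>n\<ge>N. norm (G n) \<le> \<bar>inverse t\<bar> * (norm A * \<bar>inverse t\<bar>) ^ n"
    proof (intro exI allI impI)
      fix n :: nat
      have "norm (G n) \<le> \<bar>inverse t\<bar> ^ Suc n * norm A ^ n"
        unfolding G_def norm_scaleR power_abs[symmetric] real_norm_def
        by (intro mult_left_mono norm_P) simp
      then show "norm (G n) \<le> \<bar>inverse t\<bar> * (norm A * \<bar>inverse t\<bar>) ^ n"
        by (simp add: power_mult_distrib mult_ac)
    qed
    have "norm A * \<bar>inverse t\<bar> < 1"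
      using t t0 by (simp add: abs_inverse field_simps)
    then show "summable (\<lambda>n. \<bar>inverse t\<bar> * (norm A * \<bar>inverse t\<bar>) ^ n)"
      by (intro summable_mult summable_geometric) simp
  qed
  define R where "R = suminf G"
  have GSuc: "A o\<^sub>L G n = t *\<^sub>R G (Suc n)" "G n o\<^sub>L A = t *\<^sub>R G (Suc n)" for n
    using t0 by (simp_all add: G_def comp_scaleR_right comp_scaleR_left P_chi P_Suc)
  have G_sums: "G sums R"
    unfolding R_def by (rule summable_sums[OF sumG])
  have sums_Suc: "(\<lambda>n. t *\<^sub>R G (Suc n)) sums (t *\<^sub>R (R - G 0))"
    using G_sums by (intro sums_scaleR_right) (simp add: sums_Suc_iff)
  have tG0: "t *\<^sub>R G 0 = chi E"
    using t0 by (simp add: G_def P_0)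
  have AR: "A o\<^sub>L R = t *\<^sub>R R - chi E"
  proof (rule sums_unique2)
    show "(\<lambda>n. A o\<^sub>L G n) sums (A o\<^sub>L R)"
      by (rule bounded_linear.sums[OF bounded_bilinear.bounded_linear_right[OF
              bounded_bilinear_blinfun_compose] G_sums])
    show "(\<lambda>n. A o\<^sub>L G n) sums (t *\<^sub>R R - chi E)"
      using sums_Suc by (simp add: GSuc scaleR_diff_right tG0)
  qed
  have RA: "R o\<^sub>L A = t *\<^sub>R R - chi E"
  proof (rule sums_unique2)
    show "(\<lambda>n. G n o\<^sub>L A) sums (R o\<^sub>L A)"
      by (rule bounded_linear.sums[OF bounded_bilinear.bounded_linear_left[OF
              bounded_bilinear_blinfun_compose] G_sums])
    show "(\<lambda>n. G n o\<^sub>L A) sums (t *\<^sub>R R - chi E)"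
      using sums_Suc by (simp add: GSuc scaleR_diff_right tG0)
  qed
  have chiR: "chi E o\<^sub>L R = R"
  proof (rule sums_unique2)
    show "(\<lambda>n. chi E o\<^sub>L G n) sums (chi E o\<^sub>L R)"
      by (rule bounded_linear.sums[OF bounded_bilinear.bounded_linear_right[OF
              bounded_bilinear_blinfun_compose] G_sums])
  qed (use G_sums in \<open>simp add: G_def comp_scaleR_right P_chi\<close>)
  have Rchi: "R o\<^sub>L chi E = R"
  proof (rule sums_unique2)
    show "(\<lambda>n. G n o\<^sub>L chi E) sums (R o\<^sub>L chi E)"
      by (rule bounded_linear.sums[OF bounded_bilinear.bounded_linear_left[OF
              bounded_bilinear_blinfun_compose] G_sums])
  qed (use G_sums in \<open>simp add: G_def comp_scaleR_left P_chi\<close>)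
  have R_lin: "R (scaleC_ell2 c f) = scaleC_ell2 c (R f)" for c f
  proof (rule sums_unique2)
    have app: "(\<lambda>n. G n h) sums R h" for h
      by (rule bounded_linear.sums[OF blinfun.bounded_linear_left G_sums])
    show "(\<lambda>n. G n (scaleC_ell2 c f)) sums R (scaleC_ell2 c f)"
      by (rule app)
    have "G n (scaleC_ell2 c f) = scaleC_ell2 c (G n f)" for n
      by (rule ell2_eqI) (simp add: G_def blinfun.scaleR_left P_lin)
    then show "(\<lambda>n. G n (scaleC_ell2 c f)) sums scaleC_ell2 c (R f)"
      using bounded_linear.sums[OF bounded_linear_scaleC_ell2 app] by simp
  qed
  have "bounded_op_in E (- R)"
    unfolding bounded_op_in_def
  proof (intro conjI allI)
    show "(- R) (scaleC_ell2 c f) = scaleC_ell2 c ((- R) f)" for c f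
      by (rule ell2_eqI) (simp add: blinfun.minus_left R_lin)
    show "- R = chi E o\<^sub>L - R o\<^sub>L chi E"
      by (simp add: bounded_bilinear.minus_left[OF bounded_bilinear_blinfun_compose]
          bounded_bilinear.minus_right[OF bounded_bilinear_blinfun_compose] chiR Rchi)
  qed
  moreover have "(A - complex_of_real t *\<^sub>C chi E) o\<^sub>L (- R) = chi E"
    by (simp add: scaleC_op_of_real bounded_bilinear.minus_right[OF bounded_bilinear_blinfun_compose]
        comp_diff_left comp_scaleR_left chiR AR)
  moreover have "(- R) o\<^sub>L (A - complex_of_real t *\<^sub>C chi E) = chi E"
    by (simp add: scaleC_op_of_real bounded_bilinear.minus_left[OF bounded_bilinear_blinfun_compose]
        comp_diff_right comp_scaleR_right Rchi RA)
  ultimately show ?thesis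
    unfolding spectrum_in_def by blast
qed

end

text \<open>Uniform in the operators and in the underlying set \<open>E\<close>, so that one constant serves \<open>H\<close> and all of
  its fibres, from the identity \<open>A p(A) - B p(B) = (A - B) p(A) + B (p(A) - p(B))\<close>.\<close>

lemma poly_op_Lipschitz:
  fixes p :: "real poly"
  assumes "0 \<le> M"
  shows "\<exists>K\<ge>0. \<forall>E (A :: 'a ell2_op) B. operator_on E A \<longrightarrow> operator_on E B \<longrightarrow> norm A \<le> M \<longrightarrow> norm B \<le> M \<longrightarrow>
    norm (poly_op E p A - poly_op E p B) \<le> K * norm (A - B)"
proof -
  \<comment> \<open>The bound \<open>L\<close> on \<open>p(A)\<close> has to be carried along for the step from \<open>p\<close> to \<open>X p\<close>.\<close>
  define Q where "Q p K L \<longleftrightarrow> (\<forall>E (A :: 'a ell2_op) B. operator_on E A \<longrightarrow> operator_on E B \<longrightarrow>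
      norm A \<le> M \<longrightarrow> norm B \<le> M \<longrightarrow>
      norm (poly_op E p A) \<le> L \<and> norm (poly_op E p A - poly_op E p B) \<le> K * norm (A - B))"
    for p :: "real poly" and K L :: real
  have "\<exists>K\<ge>0. \<exists>L\<ge>0. Q p K L"
  proof (induction p)
    case 0
    have "Q 0 0 0"
      by (simp add: Q_def operator_on.poly_op_0)
    then show ?case
      by blast
  next
    case (pCons a p)
    then obtain K L where K: "0 \<le> K" and L: "0 \<le> L" and Q: "Q p K L"
      by blast
    have "Q (pCons a p) (L + M * K) (\<bar>a\<bar> + M * L)"
      unfolding Q_def
    proof (intro conjI allI impI)
      fix E :: "'a set" and A B :: "'a ell2_op"
      assume A: "operator_on E A" and B: "operator_on E B" and le: "norm A \<le> M" "norm B \<le> M"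
      have IH': "norm (poly_op E p A) \<le> L"
        "norm (poly_op E p A - poly_op E p B) \<le> K * norm (A - B)"
        using Q A B le unfolding Q_def by simp_all
      have chi: "norm (a *\<^sub>R chi E) \<le> \<bar>a\<bar>"
        using mult_left_mono[OF norm_chi_le[of E] abs_ge_zero[of a]] by simp
      have "norm (A o\<^sub>L poly_op E p A) \<le> M * L"
        by (rule order_trans[OF norm_blinfun_compose mult_mono]) (use IH' le assms in auto)
      then show "norm (poly_op E (pCons a p) A) \<le> \<bar>a\<bar> + M * L"
        unfolding operator_on.poly_op_pCons[OF A] by (rule norm_triangle_mono[OF chi])
      have "poly_op E (pCons a p) A - poly_op E (pCons a p) B
          = ((A - B) o\<^sub>L poly_op E p A) + (B o\<^sub>L (poly_op E p A - poly_op E p B))"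
        by (simp add: operator_on.poly_op_pCons[OF A] operator_on.poly_op_pCons[OF B]
            comp_diff_left comp_diff_right)
      moreover have "norm ((A - B) o\<^sub>L poly_op E p A) \<le> norm (A - B) * L"
        by (rule order_trans[OF norm_blinfun_compose mult_left_mono]) (use IH' in auto)
      moreover have "norm (B o\<^sub>L (poly_op E p A - poly_op E p B)) \<le> M * (K * norm (A - B))"
        by (rule order_trans[OF norm_blinfun_compose mult_mono]) (use IH' le assms in auto)
      ultimately have "norm (poly_op E (pCons a p) A - poly_op E (pCons a p) B)
          \<le> norm (A - B) * L + M * (K * norm (A - B))"
        by (metis norm_triangle_mono)
      then show "norm (poly_op E (pCons a p) A - poly_op E (pCons a p) B)
          \<le> (L + M * K) * norm (A - B)"
        by (simp add: algebra_simps)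
    qed
    moreover have "0 \<le> L + M * K" "0 \<le> \<bar>a\<bar> + M * L"
      using K L assms by simp_all
    ultimately show ?case
      by blast
  qed
  then obtain K L where "0 \<le> K" "Q p K L"
    by blast
  then show ?thesis
    unfolding Q_def by (intro exI[of _ K]) simp
qed

section \<open>The continuous functional calculus\<close>

text \<open>Weierstrass approximation, phrased for the type of polynomials on which \<^const>\<open>poly_op\<close> acts.\<close>

lemma Weierstrass_poly:
  fixes \<kappa> :: "real \<Rightarrow> real"
  assumes "continuous_on UNIV \<kappa>" "e > 0"
  obtains p :: "real poly" where "\<And>t. \<bar>t\<bar> \<le> M \<Longrightarrow> \<bar>poly p t - \<kappa> t\<bar> < e"
proof -
  obtain g where g: "real_polynomial_function g"
    "\<And>x. x \<in> {- M..M} \<Longrightarrow> \<bar>\<kappa> x - g x\<bar> < e"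
    by (rule Stone_Weierstrass_real_polynomial_function[of "{- M..M}" \<kappa> e])
      (use assms in \<open>auto intro: continuous_on_subset\<close>)
  obtain a n where a: "g = (\<lambda>x. \<Sum>i\<le>n. a i * x ^ i)"
    using g(1) by (auto simp: real_polynomial_function_iff_sum)
  have "poly (\<Sum>i\<le>n. monom (a i) i) t = g t" for t
    by (simp add: a poly_sum poly_monom)
  then show ?thesis
    using g(2) by (intro that[of "\<Sum>i\<le>n. monom (a i) i"])
      (auto simp: abs_minus_commute[of "g _"] abs_le_iff)
qed

text \<open>Polynomials that converge to \<open>\<kappa>\<close> uniformly on \<open>[- M, M]\<close> give a norm Cauchy sequence of
  operators by \<open>norm_poly_op_le\<close>. Its limit \<open>B\<close> is also the limit along every other sequence that
  converges on the spectrum, so \<open>B\<close> is the operator that \<^const>\<open>fun_calc\<close> describes; it inherits the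
  estimate from the approximating sequence.\<close>

lemma norm_fun_calc_diff_poly_op_le:
  assumes op: "bounded_op_in E A" and sym: "symmetric_op A"
    and cont: "continuous_on UNIV \<kappa>"
    and M: "norm A \<le> M" and p: "\<And>t. \<bar>t\<bar> \<le> M \<Longrightarrow> \<bar>poly p t - \<kappa> t\<bar> \<le> \<delta>"
  shows "norm (fun_calc E \<kappa> A - poly_op E p A) \<le> \<delta>"
proof -
  interpret operator_on E A
    using op by unfold_locales (simp add: bounded_op_in_def)
  define S where "S = {t. complex_of_real t \<in> spectrum_in E A}"
  have S_le: "\<bar>t\<bar> \<le> M" if "t \<in> S" for t
    using Neumann_resolvent[of t] op that M by (fastforce simp: S_def bounded_op_in_def)
  have diff_le: "norm (poly_op E u A - poly_op E v A) \<le> c"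
    if "0 \<le> c" "\<And>t. t \<in> S \<Longrightarrow> \<bar>poly u t - poly v t\<bar> \<le> c" for u v :: "real poly" and c
    unfolding poly_op_diff[symmetric] by (rule norm_poly_op_le[OF sym]) (use that in \<open>auto simp: S_def\<close>)
  have approx: "norm (poly_op E u A - poly_op E v A) \<le> c + d"
    if "0 \<le> c" "0 \<le> d" "\<And>t. t \<in> S \<Longrightarrow> \<bar>poly u t - \<kappa> t\<bar> \<le> c"
      "\<And>t. t \<in> S \<Longrightarrow> \<bar>poly v t - \<kappa> t\<bar> \<le> d" for u v c d
    by (rule diff_le) (use that in \<open>fastforce+\<close>)
  have "\<exists>P. \<forall>t. \<bar>t\<bar> \<le> M \<longrightarrow> \<bar>poly P t - \<kappa> t\<bar> < inverse (real (Suc n))" for n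
    using Weierstrass_poly[OF cont, of "inverse (real (Suc n))" M] by (metis inverse_positive_iff_positive of_nat_0_less_iff zero_less_Suc)
  then obtain P where P: "\<And>n t. \<bar>t\<bar> \<le> M \<Longrightarrow> \<bar>poly (P n) t - \<kappa> t\<bar> < inverse (real (Suc n))"
    by metis
  have P_S: "\<bar>poly (P n) t - \<kappa> t\<bar> \<le> inverse (real (Suc n))" if "t \<in> S" for n t
    using P[OF S_le[OF that], of n] by simp
  have small: "\<exists>no. \<forall>n\<ge>no. inverse (real (Suc n)) < e" if "e > 0" for e
    using LIMSEQ_inverse_real_of_nat that by (auto simp: lim_sequentially)
  have "Cauchy (\<lambda>n. poly_op E (P n) A)"
  proof (rule CauchyI)
    fix e :: real
    assume "0 < e"
    then obtain no where no: "\<And>n. n \<ge> no \<Longrightarrow> inverse (real (Suc n)) < e / 2"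
      using small[of "e / 2"] by auto
    have "norm (poly_op E (P m) A - poly_op E (P n) A) < e" if "m \<ge> no" "n \<ge> no" for m n
      using approx[OF _ _ P_S P_S, of m n] no[OF that(1)] no[OF that(2)] by fastforce
    then show "\<exists>M. \<forall>m\<ge>M. \<forall>n\<ge>M. norm (poly_op E (P m) A - poly_op E (P n) A) < e"
      by blast
  qed
  then obtain B where B: "(\<lambda>n. poly_op E (P n) A) \<longlonglongrightarrow> B"
    by (auto simp: Cauchy_convergent_iff convergent_def)
  have dist_B: "norm (B - poly_op E u A) \<le> d"
    if "0 \<le> d" "\<And>t. t \<in> S \<Longrightarrow> \<bar>poly u t - \<kappa> t\<bar> \<le> d" for u d
  proof (rule LIMSEQ_le)
    show "(\<lambda>n. norm (poly_op E (P n) A - poly_op E u A)) \<longlonglongrightarrow> norm (B - poly_op E u A)"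
      by (intro tendsto_intros B)
    show "(\<lambda>n. inverse (real (Suc n)) + d) \<longlonglongrightarrow> d"
      using tendsto_add[OF LIMSEQ_inverse_real_of_nat tendsto_const[of d]] by simp
    show "\<exists>N. \<forall>n\<ge>N. norm (poly_op E (P n) A - poly_op E u A) \<le> inverse (real (Suc n)) + d"
      using approx[OF _ that(1) P_S that(2)] by auto
  qed
  have "fun_calc E \<kappa> A = B"
    unfolding fun_calc_def S_def[symmetric]
  proof (rule the_equality)
    show "\<forall>p. uniform_limit S (\<lambda>n. poly (p n)) \<kappa> sequentially \<longrightarrow> (\<lambda>n. poly_op E (p n) A) \<longlonglongrightarrow> B"
    proof (intro allI impI LIMSEQ_I)
      fix u :: "nat \<Rightarrow> real poly" and e :: real
      assume u: "uniform_limit S (\<lambda>n. poly (u n)) \<kappa> sequentially" and "0 < e"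
      then obtain no where "\<forall>n\<ge>no. \<forall>t\<in>S. dist (poly (u n) t) (\<kappa> t) < e / 2"
        unfolding uniform_limit_sequentially_iff by (metis half_gt_zero)
      then have "norm (B - poly_op E (u n) A) \<le> e / 2" if "n \<ge> no" for n
        using that \<open>0 < e\<close> by (intro dist_B) (auto simp: dist_real_def less_imp_le)
      then show "\<exists>no. \<forall>n\<ge>no. norm (poly_op E (u n) A - B) < e"
        using \<open>0 < e\<close> by (intro exI[of _ no]) (fastforce simp: norm_minus_commute)
    qed
  next
    fix B'
    assume "\<forall>p. uniform_limit S (\<lambda>n. poly (p n)) \<kappa> sequentially \<longrightarrow> (\<lambda>n. poly_op E (p n) A) \<longlonglongrightarrow> B'"
    moreover have "uniform_limit S (\<lambda>n. poly (P n)) \<kappa> sequentially"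
      unfolding uniform_limit_sequentially_iff dist_real_def
      using small P_S by (meson le_less_trans)
    ultimately show "B' = B"
      using B LIMSEQ_unique by blast
  qed
  moreover have "0 \<le> \<delta>"
    using p[of 0] M norm_ge_zero[of A] by (smt (verit))
  ultimately show ?thesis
    using dist_B[of \<delta> p] p S_le by blast
qed

section \<open>Toeplitz operators as absolutely convergent sums\<close>

lift_definition ket :: "'a \<Rightarrow> 'a ell2" is "\<lambda>x y. if y = x then 1 else 0"
  by (rule finite_nonzero_values_imp_summable_on) (rule finite_subset[of _ "{x}" for x], auto)

lemma ell2_apply_ket: "ell2_apply (ket x) y = (if y = x then 1 else 0)"
  by (simp add: ket.rep_eq)

lemma cinner_ket: "cinner (ket x) h = ell2_apply h x"
proof -
  have "cinner (ket x) h = (\<Sum>\<^sub>\<infinity>y\<in>{x}. cnj (ell2_apply (ket x) y) * ell2_apply h y)"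
    unfolding cinner_def by (rule infsum_cong_neutral) (auto simp: ell2_apply_ket)
  then show ?thesis
    by (simp add: ell2_apply_ket)
qed

lemma inner_ket: "ket x \<bullet> h = Re (ell2_apply h x)"
  by (metis Re_cinner cinner_ket)

lemma inner_ket': "h \<bullet> ket x = Re (ell2_apply h x)"
  by (simp add: inner_commute[of h] inner_ket)

lemma inner_scaleC_ket:
  "scaleC_ell2 a (ket u) \<bullet> scaleC_ell2 b (ket v) = (if u = v then Re (cnj a * b) else 0)"
  by (simp add: inner_scaleC_ell2 scaleC_ell2_scaleC inner_ket ell2_apply_ket)

lemma norm_sq_finite_support:
  assumes "finite S" "\<And>x. ell2_apply f x \<noteq> 0 \<Longrightarrow> x \<in> S"
  shows "(norm f)\<^sup>2 = (\<Sum>x\<in>S. (cmod (ell2_apply f x))\<^sup>2)"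
proof -
  have "(norm f)\<^sup>2 = (\<Sum>\<^sub>\<infinity>x\<in>S. (cmod (ell2_apply f x))\<^sup>2)"
    unfolding norm_ell2_power2 by (rule infsum_cong_neutral) (use assms in auto)
  then show ?thesis
    using assms(1) by simp
qed

lemma chi_ket: "chi_ell2 G (ket z) = (if z \<in> G then ket z else 0)"
  by (rule ell2_eqI) (simp add: ell2_apply_ket)

text \<open>Uniqueness of the adjoint comes from testing against the basis vectors, which read off
  coordinates.\<close>

lemma adj_eqI:
  assumes "\<And>f g. cinner (blinfun_apply A f) g = cinner f (blinfun_apply B g)"
  shows "adj A = B"
  unfolding adj_def
proof (rule the_equality)
  fix B'
  assume B': "\<forall>f g. cinner (blinfun_apply A f) g = cinner f (blinfun_apply B' g)"
  show "B' = B"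
  proof (rule blinfun_eqI, rule ell2_eqI)
    fix g x
    show "ell2_apply (B' g) x = ell2_apply (B g) x"
      using B' assms cinner_ket by metis
  qed
qed (use assms in blast)

lemma ell2_apply_compressed_shift:
  "ell2_apply (compressed_shift E \<eta> f) x =
    (if x \<in> E \<and> x - \<eta> \<in> E then ell2_apply f (x - \<eta>) else 0)"
  by (simp add: compressed_shift_def)

lemma compressed_shift_ket:
  "compressed_shift G \<eta> (ket z) = (if z \<in> G \<and> z + \<eta> \<in> G then ket (z + \<eta>) else 0)"
  by (rule ell2_eqI) (auto simp: ell2_apply_compressed_shift ell2_apply_ket algebra_simps)

lemma cinner_compressed_shift:
  "cinner (compressed_shift E \<eta> f) g = cinner f (compressed_shift E (- \<eta>) g)"
  unfolding cinner_def
  by (rule infsum_reindex_bij_witness[where j = "\<lambda>x. x - \<eta>" and i = "\<lambda>x. x + \<eta>"])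
    (auto simp: ell2_apply_compressed_shift)

lemma adj_compressed_shift: "adj (compressed_shift E \<eta>) = compressed_shift E (- \<eta>)"
  by (rule adj_eqI) (rule cinner_compressed_shift)

text \<open>The operator \<open>v\<^sub>\<eta> v\<^sub>\<eta>\<^sup>*\<close> is the multiplication by the characteristic function of this set.\<close>

definition overlap :: "'a::ab_group_add set \<Rightarrow> 'a \<Rightarrow> 'a set" where
  "overlap E \<eta> = {x \<in> E. x - \<eta> \<in> E}"

lemma compressed_shift_comp_adj:
  "compressed_shift E \<eta> o\<^sub>L adj (compressed_shift E \<eta>) = chi (overlap E \<eta>)"
  by (rule blinfun_eqI, rule ell2_eqI)
    (simp add: adj_compressed_shift ell2_apply_compressed_shift overlap_def)

lemma toeplitz_V_eq: "toeplitz_V X E \<rho> = (\<Sum>\<^sub>\<infinity>\<eta>\<in>X. \<rho> \<eta> *\<^sub>C chi (overlap E \<eta>))"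
  by (simp add: toeplitz_V_def compressed_shift_comp_adj)

lemma norm_compressed_shift_le: "norm (compressed_shift E \<eta>) \<le> 1"
proof (rule norm_blinfun_bound)
  fix f :: "'a ell2"
  have "norm (shift_ell2 \<eta> g) = norm g" for g
    unfolding norm_eq_sqrt_inner inner_ell2_def
    by (subst infsum_reindex_bij_witness[where j = "\<lambda>x. x - \<eta>" and i = "\<lambda>x. x + \<eta>"
          and h = "\<lambda>x. ell2_apply g x \<bullet> ell2_apply g x" and T = UNIV]) auto
  then show "norm (compressed_shift E \<eta> f) \<le> 1 * norm f"
    using norm_chi_ell2_le[of E "shift_ell2 \<eta> (chi_ell2 E f)"] norm_chi_ell2_le[of E f]
    by (simp add: compressed_shift_def)
qed simp

lemma inner_compressed_shift:
  "compressed_shift E \<eta> f \<bullet> g = f \<bullet> compressed_shift E (- \<eta>) g"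
  by (metis Re_cinner cinner_compressed_shift)

lemma bounded_op_inI:
  assumes "\<And>c f. blinfun_apply A (scaleC_ell2 c f) = scaleC_ell2 c (blinfun_apply A f)"
    and "chi E o\<^sub>L A o\<^sub>L chi E = A"
  shows "bounded_op_in E A"
  using assms by (simp add: bounded_op_in_def)

lemma bounded_op_inD:
  assumes "bounded_op_in E A"
  shows "blinfun_apply A (scaleC_ell2 c f) = scaleC_ell2 c (blinfun_apply A f)"
    and "chi E o\<^sub>L A o\<^sub>L chi E = A"
  using assms unfolding bounded_op_in_def by auto

lemma operator_onI: "bounded_op_in G A \<Longrightarrow> operator_on G A"
  by unfold_locales (simp add: bounded_op_inD(2))

lemma bounded_op_in_compressed_shift: "bounded_op_in E (compressed_shift E \<eta>)"
  by (rule bounded_op_inI)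
    (auto intro!: ell2_eqI blinfun_eqI simp: ell2_apply_compressed_shift)

lemma bounded_op_in_chi: "F \<subseteq> E \<Longrightarrow> bounded_op_in E (chi F)"
  by (rule bounded_op_inI) (auto intro!: ell2_eqI blinfun_eqI)

lemma bounded_op_in_add:
  assumes "bounded_op_in E A" "bounded_op_in E B"
  shows "bounded_op_in E (A + B)"
proof (rule bounded_op_inI)
  show "(A + B) (scaleC_ell2 c f) = scaleC_ell2 c ((A + B) f)" for c f
    by (rule ell2_eqI) (simp add: blinfun.add_left bounded_op_inD(1)[OF assms(1)]
        bounded_op_inD(1)[OF assms(2)] algebra_simps)
qed (simp add: comp_add_left comp_add_right bounded_op_inD(2)[OF assms(1)]
    bounded_op_inD(2)[OF assms(2)])

lemma bounded_op_in_0: "bounded_op_in E 0"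
  by (rule bounded_op_inI) (auto intro!: ell2_eqI simp: comp_0_left comp_0_right)

lemma bounded_op_in_sum:
  "(\<And>i. i \<in> F \<Longrightarrow> bounded_op_in E (A i)) \<Longrightarrow> bounded_op_in E (\<Sum>i\<in>F. A i)"
  by (induction F rule: infinite_finite_induct) (simp_all add: bounded_op_in_0 bounded_op_in_add)

lemma bounded_op_in_scaleC:
  assumes "bounded_op_in E A"
  shows "bounded_op_in E (c *\<^sub>C A)"
proof (rule bounded_op_inI)
  show "(c *\<^sub>C A) (scaleC_ell2 d f) = scaleC_ell2 d ((c *\<^sub>C A) f)" for d f
    by (simp add: bounded_op_inD(1)[OF assms] scaleC_ell2_scaleC mult.commute)
  have "chi E o\<^sub>L (c *\<^sub>C A) o\<^sub>L chi E = c *\<^sub>C (chi E o\<^sub>L A o\<^sub>L chi E)"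
    by (rule blinfun_eqI) (simp add: scaleC_chi_ell2)
  then show "chi E o\<^sub>L (c *\<^sub>C A) o\<^sub>L chi E = c *\<^sub>C A"
    by (simp add: bounded_op_inD(2)[OF assms])
qed

lemma weighted_abs_summable:
  assumes "(\<lambda>x. cmod (\<rho> x)) summable_on X" "\<And>x. norm (a x) \<le> 1"
  shows "(\<lambda>x. norm (\<rho> x *\<^sub>C a x)) summable_on X"
proof (rule Infinite_Sum.abs_summable_on_comparison_test'[OF assms(1)])
  fix x
  show "norm (\<rho> x *\<^sub>C a x) \<le> cmod (\<rho> x)"
    using norm_scaleC_op[of "\<rho> x" "a x"] mult_left_mono[OF assms(2)[of x] norm_ge_zero[of "\<rho> x"]]
    by simp
qed

lemma weighted_summable:
  assumes "(\<lambda>x. cmod (\<rho> x)) summable_on X" "\<And>x. norm (a x) \<le> 1"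
  shows "(\<lambda>x. \<rho> x *\<^sub>C a x) summable_on X"
  by (rule abs_summable_summable[OF weighted_abs_summable[OF assms]])

lemma norm_weighted_sum_le:
  assumes "(\<lambda>x. cmod (\<rho> x)) summable_on X" "\<And>x. norm (a x) \<le> 1"
  shows "norm (\<Sum>\<^sub>\<infinity>x\<in>X. \<rho> x *\<^sub>C a x) \<le> (\<Sum>\<^sub>\<infinity>x\<in>X. cmod (\<rho> x))"
proof (rule norm_infsum_le)
  show "((\<lambda>x. \<rho> x *\<^sub>C a x) has_sum (\<Sum>\<^sub>\<infinity>x\<in>X. \<rho> x *\<^sub>C a x)) X"
    by (rule has_sum_infsum[OF weighted_summable[OF assms]])
  show "((\<lambda>x. cmod (\<rho> x)) has_sum (\<Sum>\<^sub>\<infinity>x\<in>X. cmod (\<rho> x))) X"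
    by (rule has_sum_infsum[OF assms(1)])
  show "norm (\<rho> x *\<^sub>C a x) \<le> cmod (\<rho> x)" for x
    using norm_scaleC_op[of "\<rho> x" "a x"] mult_left_mono[OF assms(2)[of x] norm_ge_zero[of "\<rho> x"]]
    by simp
qed

lemma bounded_op_in_weighted_sum:
  assumes "(\<lambda>x. cmod (\<rho> x)) summable_on X" "\<And>x. norm (a x) \<le> 1" "\<And>x. bounded_op_in E (a x)"
  shows "bounded_op_in E (\<Sum>\<^sub>\<infinity>x\<in>X. \<rho> x *\<^sub>C a x)"
proof -
  have sm: "(\<lambda>x. \<rho> x *\<^sub>C a x) summable_on X"
    by (rule weighted_summable[OF assms(1,2)])
  have op: "bounded_op_in E (\<rho> x *\<^sub>C a x)" for x
    by (rule bounded_op_in_scaleC[OF assms(3)])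
  have app: "blinfun_apply (\<Sum>\<^sub>\<infinity>x\<in>X. \<rho> x *\<^sub>C a x) f = (\<Sum>\<^sub>\<infinity>x\<in>X. (\<rho> x *\<^sub>C a x) f)"
    and sapp: "(\<lambda>x. (\<rho> x *\<^sub>C a x) f) summable_on X" for f
    by (rule infsum_bounded_linear[OF blinfun.bounded_linear_left sm, symmetric]
        summable_on_bounded_linear[OF blinfun.bounded_linear_left sm])+
  show ?thesis
  proof (rule bounded_op_inI)
    fix c f
    show "blinfun_apply (\<Sum>\<^sub>\<infinity>x\<in>X. \<rho> x *\<^sub>C a x) (scaleC_ell2 c f)
        = scaleC_ell2 c (blinfun_apply (\<Sum>\<^sub>\<infinity>x\<in>X. \<rho> x *\<^sub>C a x) f)"
      unfolding app infsum_bounded_linear[OF bounded_linear_scaleC_ell2 sapp, symmetric]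
      by (rule infsum_cong) (rule bounded_op_inD(1)[OF op])
  next
    have bl: "bounded_linear (\<lambda>A. chi E o\<^sub>L A o\<^sub>L chi E)"
      by (intro bounded_linear_compose[OF bounded_bilinear.bounded_linear_left[OF
              bounded_bilinear_blinfun_compose] bounded_bilinear.bounded_linear_right[OF
              bounded_bilinear_blinfun_compose]])
    show "chi E o\<^sub>L (\<Sum>\<^sub>\<infinity>x\<in>X. \<rho> x *\<^sub>C a x) o\<^sub>L chi E = (\<Sum>\<^sub>\<infinity>x\<in>X. \<rho> x *\<^sub>C a x)"
      unfolding infsum_bounded_linear[OF bl sm, symmetric]
      by (rule infsum_cong) (rule bounded_op_inD(2)[OF op])
  qed
qed

lemma inner_weighted_sum:
  assumes "(\<lambda>x. cmod (\<rho> x)) summable_on X" "\<And>x. norm (a x) \<le> 1"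
  shows "blinfun_apply (\<Sum>\<^sub>\<infinity>x\<in>X. \<rho> x *\<^sub>C a x) f \<bullet> g = (\<Sum>\<^sub>\<infinity>x\<in>X. scaleC_ell2 (\<rho> x) (a x f) \<bullet> g)"
proof -
  have "bounded_linear (\<lambda>A. blinfun_apply A f \<bullet> g)"
    by (intro bounded_linear_inner_left_comp blinfun.bounded_linear_left)
  from infsum_bounded_linear[OF this weighted_summable[OF assms]] show ?thesis
    by simp
qed

text \<open>The involution \<open>\<sigma>\<close> sends the label of a term to the label of its adjoint: \<open>\<eta> \<mapsto> - \<eta>\<close> for
  translations, the identity for multiplication operators.\<close>

lemma symmetric_op_weighted_sum:
  assumes sm: "(\<lambda>x. cmod (\<rho> x)) summable_on X" and a: "\<And>x. norm (a x) \<le> 1"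
    and adj: "\<And>x f g. blinfun_apply (a x) f \<bullet> g = f \<bullet> blinfun_apply (a (\<sigma> x)) g"
    and lin: "\<And>x c f. blinfun_apply (a x) (scaleC_ell2 c f) = scaleC_ell2 c (blinfun_apply (a x) f)"
    and \<sigma>: "\<And>x. x \<in> X \<Longrightarrow> \<sigma> x \<in> X" "\<And>x. x \<in> X \<Longrightarrow> \<sigma> (\<sigma> x) = x"
    and \<rho>: "\<And>x. x \<in> X \<Longrightarrow> \<rho> (\<sigma> x) = cnj (\<rho> x)"
  shows "symmetric_op (\<Sum>\<^sub>\<infinity>x\<in>X. \<rho> x *\<^sub>C a x)"
  unfolding symmetric_op_def
proof (intro allI)
  fix f g
  have "blinfun_apply (\<Sum>\<^sub>\<infinity>x\<in>X. \<rho> x *\<^sub>C a x) f \<bullet> g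
      = (\<Sum>\<^sub>\<infinity>x\<in>X. scaleC_ell2 (\<rho> x) (a x f) \<bullet> g)"
    by (rule inner_weighted_sum[OF sm a])
  also have "\<dots> = (\<Sum>\<^sub>\<infinity>x\<in>X. scaleC_ell2 (\<rho> x) (a x g) \<bullet> f)"
  proof (rule infsum_reindex_bij_witness[where i = \<sigma> and j = \<sigma>])
    fix x assume x: "x \<in> X"
    have "scaleC_ell2 (\<rho> (\<sigma> x)) (a (\<sigma> x) g) \<bullet> f = a (\<sigma> x) g \<bullet> scaleC_ell2 (\<rho> x) f"
      by (simp add: inner_scaleC_ell2 \<rho>[OF x])
    also have "\<dots> = scaleC_ell2 (\<rho> x) (a x f) \<bullet> g"
      using adj[of "\<sigma> x" g "scaleC_ell2 (\<rho> x) f"] \<sigma>(2)[OF x] by (simp add: lin inner_commute)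
    finally show "scaleC_ell2 (\<rho> (\<sigma> x)) (a (\<sigma> x) g) \<bullet> f = scaleC_ell2 (\<rho> x) (a x f) \<bullet> g" .
  qed (use \<sigma> in auto)
  also have "\<dots> = f \<bullet> blinfun_apply (\<Sum>\<^sub>\<infinity>x\<in>X. \<rho> x *\<^sub>C a x) g"
    using inner_weighted_sum[OF sm a, where f = g and g = f] by (simp add: inner_commute)
  finally show "blinfun_apply (\<Sum>\<^sub>\<infinity>x\<in>X. \<rho> x *\<^sub>C a x) f \<bullet> g
      = f \<bullet> blinfun_apply (\<Sum>\<^sub>\<infinity>x\<in>X. \<rho> x *\<^sub>C a x) g" .
qed

lemma norm_weighted_sum_tail_le:
  fixes w :: "'x \<Rightarrow> real"
  assumes w: "w summable_on X" and F: "finite F" "F \<subseteq> X"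
    and le: "\<And>x. x \<in> X \<Longrightarrow> cmod (\<rho> x) \<le> w x" and a: "\<And>x. norm (a x) \<le> 1"
  shows "norm ((\<Sum>\<^sub>\<infinity>x\<in>X. \<rho> x *\<^sub>C a x) - (\<Sum>x\<in>F. \<rho> x *\<^sub>C a x)) \<le> infsum w X - sum w F"
proof -
  have \<rho>: "(\<lambda>x. cmod (\<rho> x)) summable_on X"
    using w le by (rule Infinite_Sum.abs_summable_on_comparison_test')
  have sub: "X - F \<subseteq> X" by auto
  have "(\<Sum>\<^sub>\<infinity>x\<in>X. \<rho> x *\<^sub>C a x) - (\<Sum>x\<in>F. \<rho> x *\<^sub>C a x) = (\<Sum>\<^sub>\<infinity>x\<in>X - F. \<rho> x *\<^sub>C a x)"
    using F by (subst infsum_Diff) (auto intro!: weighted_summable \<rho> a)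
  also have "norm \<dots> \<le> (\<Sum>\<^sub>\<infinity>x\<in>X - F. cmod (\<rho> x))"
    by (rule norm_weighted_sum_le[OF summable_on_subset_banach[OF \<rho> sub] a])
  also have "\<dots> \<le> (\<Sum>\<^sub>\<infinity>x\<in>X - F. w x)"
    by (rule infsum_mono[OF summable_on_subset_banach[OF \<rho> sub] summable_on_subset_banach[OF w sub]])
      (use le in auto)
  also have "\<dots> = infsum w X - sum w F"
    using F by (subst infsum_Diff) (auto intro!: w)
  finally show ?thesis .
qed

text \<open>Applied to the sum of the moduli of both coefficient functions, this yields one finite set that
  serves the operator and all of its fibres, since phases do not change moduli.\<close>

lemma finite_small_tail:
  fixes w :: "'x \<Rightarrow> real"
  assumes w: "w summable_on X" and "\<delta> > 0"
  obtains F where "finite F" "F \<subseteq> X" "infsum w X - sum w F \<le> \<delta>"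
proof -
  obtain F where "finite F" "F \<subseteq> X" "dist (sum w F) (infsum w X) < \<delta>"
    using has_sum_infsum[OF w] \<open>\<delta> > 0\<close>
    unfolding has_sum_def tendsto_iff eventually_finite_subsets_at_top by (meson order_refl)
  then show ?thesis
    using that[of F] by (simp add: dist_real_def)
qed

text \<open>Matrix elements recover the coefficients; this is how self-adjointness of the operator turns into a
  symmetry of \<open>\<phi>\<close>.\<close>

lemma inner_ket_toeplitz_T_ket:
  assumes \<rho>: "(\<lambda>x. cmod (\<rho> x)) summable_on X" and "x \<in> E" "y \<in> E" "x - y \<in> X"
  shows "ket x \<bullet> toeplitz_T X E \<rho> (ket y) = Re (\<rho> (x - y))"
proof -
  have "toeplitz_T X E \<rho> (ket y) \<bullet> ket x
      = (\<Sum>\<^sub>\<infinity>\<eta>\<in>X. scaleC_ell2 (\<rho> \<eta>) (compressed_shift E \<eta> (ket y)) \<bullet> ket x)"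
    unfolding toeplitz_T_def by (rule inner_weighted_sum[OF \<rho> norm_compressed_shift_le])
  also have "\<dots> = (\<Sum>\<^sub>\<infinity>\<eta>\<in>{x - y}. Re (\<rho> \<eta>))"
    using assms by (intro infsum_cong_neutral)
      (auto simp: inner_ket' ell2_apply_compressed_shift ell2_apply_ket)
  finally show ?thesis
    by (simp add: inner_commute)
qed

lemma inner_ket_toeplitz_V_ket:
  assumes \<rho>: "(\<lambda>x. cmod (\<rho> x)) summable_on X" and "x \<noteq> y"
  shows "ket x \<bullet> toeplitz_V X E \<rho> (ket y) = 0"
proof -
  have "toeplitz_V X E \<rho> (ket y) \<bullet> ket x
      = (\<Sum>\<^sub>\<infinity>\<eta>\<in>X. scaleC_ell2 (\<rho> \<eta>) (chi (overlap E \<eta>) (ket y)) \<bullet> ket x)"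
    unfolding toeplitz_V_eq by (rule inner_weighted_sum[OF \<rho> norm_chi_le])
  also have "\<dots> = 0"
    using assms by (intro infsum_0)
      (auto simp: inner_ket' ell2_apply_ket)
  finally show ?thesis
    by (simp add: inner_commute)
qed

section \<open>Coordinates adapted to a gap\<close>

text \<open>The exponential in the definitions of \<^const>\<open>mu\<close> and \<^const>\<open>nu\<close>.\<close>

definition wave :: "real \<Rightarrow> int \<Rightarrow> complex" where
  "wave \<tau> k = exp (- 2 * complex_of_real pi * \<i> * of_int k * complex_of_real \<tau>)"

lemma wave_add: "wave \<tau> (k + l) = wave \<tau> k * wave \<tau> l"
  by (simp add: wave_def algebra_simps flip: exp_add)

lemma wave_uminus: "wave \<tau> (- k) = cnj (wave \<tau> k)"
  by (simp add: wave_def exp_cnj)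

lemma norm_wave: "cmod (wave \<tau> k) = 1"
  by (simp add: wave_def norm_exp_eq_Re)

lemma wave_0: "wave 0 k = 1"
  by (simp add: wave_def)

text \<open>Orthogonality of characters of the cyclic group of order \<open>L\<close>: a geometric sum of the powers of an
  \<open>L\<close>-th root of unity, different from 1 when \<open>0 < \<bar>d\<bar> < L\<close>.\<close>

lemma sum_wave:
  fixes L :: nat
  assumes "\<bar>d\<bar> < int L"
  shows "(\<Sum>m<L. wave (real m / real L) d) = (if d = 0 then of_nat L else 0)"
proof (cases "d = 0")
  case True
  then show ?thesis by (simp add: wave_def)
next
  case False
  have L: "L > 0"
    using assms by (cases L) auto
  define z where "z = exp (- 2 * complex_of_real pi * \<i> * of_int d / of_nat L)"
  have pow: "wave (real m / real L) d = z ^ m" for m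
    by (simp add: wave_def z_def algebra_simps flip: exp_of_nat_mult)
  have "z ^ L = exp (- (2 * complex_of_real pi * \<i> * of_int d))"
    using L by (simp add: z_def flip: exp_of_nat_mult)
  also have "\<dots> = 1"
    by (auto simp: exp_eq_1 intro!: exI[of _ "- d"])
  finally have "z ^ L = 1" .
  moreover have "z \<noteq> 1"
  proof
    assume "z = 1"
    then obtain n :: int where "- 2 * pi * real_of_int d / real L = of_int (2 * n) * pi"
      unfolding z_def exp_eq_1 by auto
    then have "pi * (- real_of_int d) = pi * (real_of_int n * real L)"
      using L by (simp add: field_simps)
    then have "- real_of_int d = real_of_int n * real L"
      using pi_neq_zero mult_left_cancel by blast
    then have d: "- d = n * int L"
      by (metis of_int_eq_iff of_int_minus of_int_mult of_int_of_nat_eq)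
    then have "n \<noteq> 0"
      using False by auto
    then have "int L \<le> \<bar>n\<bar> * int L"
      using L by (simp add: mult_le_cancel_right1)
    then show False
      using assms d by (metis abs_minus_cancel abs_mult abs_of_nat linorder_not_le)
  qed
  ultimately show ?thesis
    using False by (simp add: pow geometric_sum)
qed

text \<open>A point \<open>x\<close> of the lattice is described by its first coordinate \<open>x 1\<close>, by its increment at \<open>j\<close>, and
  by its other increments, which are labelled by \<open>rest\<close>. The map \<open>proj\<close> collects the latter and
  \<open>join\<close> rebuilds the point. Translations in the first two directions act on \<open>x 1\<close> and \<open>gap x\<close>
  only.\<close>

locale lattice_gap =
  fixes N j :: nat
  assumes j: "2 \<le> j" "j \<le> N"
begin

definition "rest = {2..N} - {j}"
definition "gap x = (x j - x (j - 1) :: int)" for x :: "nat \<Rightarrow> int"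
definition "proj x = (\<lambda>i. if i \<in> rest then x i - x (i - 1) else 0 :: int)" for x :: "nat \<Rightarrow> int"
definition "join k l z = theta_inv N ((z(j := l))(1 := k))" for k l :: int and z
definition "X = int_lattice {1..N}"
abbreviation "E \<equiv> ordered_cone N"
abbreviation "X' \<equiv> int_lattice rest"
abbreviation "E' \<equiv> positive_cone rest"

lemma gap_add: "gap (x + y) = gap x + gap y" and gap_diff: "gap (x - y) = gap x - gap y"
  and gap_uminus: "gap (- x) = - gap x"
  by (simp_all add: gap_def)

lemma proj_add: "proj (x + y) = proj x + proj y" and proj_diff: "proj (x - y) = proj x - proj y"
  and proj_uminus: "proj (- x) = - proj x"
  by (auto simp: proj_def fun_eq_iff)

lemma X_add: "x \<in> X \<Longrightarrow> y \<in> X \<Longrightarrow> x + y \<in> X" and X_diff: "x \<in> X \<Longrightarrow> y \<in> X \<Longrightarrow> x - y \<in> X"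
  and X_uminus: "x \<in> X \<Longrightarrow> - x \<in> X"
  by (simp_all add: X_def int_lattice_def)

lemma proj_in: "proj x \<in> X'"
  by (simp add: proj_def int_lattice_def)

text \<open>In these coordinates the ordered cone is a product: the gap enters only through the condition that
  it be positive, and the remaining increments range over the positive cone of the fibre.\<close>

lemma in_ordered_cone_iff:
  assumes "x \<in> X"
  shows "x \<in> E \<longleftrightarrow> 1 \<le> gap x \<and> proj x \<in> E'"
proof -
  have "x \<in> E \<longleftrightarrow> (\<forall>i\<in>{2..N}. x (i - 1) < x i)"
  proof -
    have "(\<forall>i\<in>{1..<N}. x i < x (Suc i)) \<longleftrightarrow> (\<forall>i\<in>Suc ` {1..<N}. x (i - 1) < x i)"
      by (simp del: image_Suc_atLeastLessThan)
    also have "Suc ` {1..<N} = {2..N}"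
      by (simp add: image_Suc_atLeastLessThan atLeastLessThanSuc_atLeastAtMost numeral_2_eq_2)
    finally show ?thesis
      using assms by (simp add: X_def ordered_cone_def)
  qed
  also have "\<dots> \<longleftrightarrow> x (j - 1) < x j \<and> (\<forall>i\<in>rest. x (i - 1) < x i)"
    using j by (auto simp: rest_def)
  also have "\<dots> \<longleftrightarrow> 1 \<le> gap x \<and> proj x \<in> E'"
  proof -
    have "proj x \<in> E' \<longleftrightarrow> (\<forall>i\<in>rest. 1 \<le> proj x i)"
      by (simp add: positive_cone_def proj_in)
    also have "\<dots> \<longleftrightarrow> (\<forall>i\<in>rest. x (i - 1) < x i)"
      by (intro ball_cong) (auto simp: proj_def)
    finally show ?thesis
      by (auto simp: gap_def)
  qed
  finally show ?thesis .
qed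

lemma theta_inv_diff:
  assumes "i \<in> {1..N}"
  shows "theta_inv N \<zeta> i - theta_inv N \<zeta> (i - 1) = \<zeta> i"
proof (cases i)
  case (Suc m)
  then show ?thesis
    using assms by (cases m) (auto simp: theta_inv_def)
qed (use assms in auto)

lemma theta_inv_increments:
  assumes "x \<in> X"
  shows "theta_inv N (\<lambda>i. x i - x (i - 1)) = x"
proof -
  have "(\<Sum>l=1..i. x l - x (l - 1)) = x i - x 0" for i
    by (induction i) auto
  then show ?thesis
    using assms by (auto simp: X_def theta_inv_def int_lattice_def fun_eq_iff)
qed

lemma theta_inv_cong: "(\<And>i. i \<in> {1..N} \<Longrightarrow> \<zeta> i = \<zeta>' i) \<Longrightarrow> theta_inv N \<zeta> = theta_inv N \<zeta>'"
  by (auto simp: theta_inv_def fun_eq_iff intro!: sum.cong)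

lemma join_in: "join k l z \<in> X"
  by (simp add: X_def join_def theta_inv_def int_lattice_def)

lemma join_1: "join k l z 1 = k"
  using j by (simp add: join_def theta_inv_def)

lemma gap_join: "gap (join k l z) = l"
  using j theta_inv_diff[of j "(z(j := l))(1 := k)"] by (simp add: gap_def join_def)

lemma proj_join: "z \<in> X' \<Longrightarrow> proj (join k l z) = z"
  using theta_inv_diff[of _ "(z(j := l))(1 := k)"]
  by (auto simp: proj_def join_def fun_eq_iff rest_def int_lattice_def)

lemma join_coordinates:
  assumes "x \<in> X"
  shows "join (x 1) (gap x) (proj x) = x"
proof -
  have "join (x 1) (gap x) (proj x) = theta_inv N (\<lambda>i. x i - x (i - 1))"
    unfolding join_def
    by (rule theta_inv_cong) (use assms in \<open>auto simp: gap_def proj_def rest_def X_def int_lattice_def\<close>)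
  then show ?thesis
    using theta_inv_increments[OF assms] by simp
qed

lemma coordinates_inj:
  assumes "x \<in> X" "y \<in> X" "x 1 = y 1" "gap x = gap y" "proj x = proj y"
  shows "x = y"
  using join_coordinates assms by metis

definition "phase \<tau> \<tau>' x = wave \<tau> (x 1) * wave \<tau>' (gap x)" for x :: "nat \<Rightarrow> int"

lemma phase_add: "phase \<tau> \<tau>' (x + y) = phase \<tau> \<tau>' x * phase \<tau> \<tau>' y"
  by (simp add: phase_def gap_add wave_add)

lemma phase_uminus: "phase \<tau> \<tau>' (- x) = cnj (phase \<tau> \<tau>' x)"
  by (simp add: phase_def gap_uminus wave_uminus)

lemma norm_phase: "cmod (phase \<tau> \<tau>' x) = 1"
  by (simp add: phase_def norm_mult norm_wave)

lemma phase_0: "phase 0 0 x = 1"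
  by (simp add: phase_def wave_0)

text \<open>The partial Fourier transforms sum the coefficients along the fibres of \<open>proj\<close> with a phase. By
  absolute convergence the summations over the fibres and over their labels combine into one sum over
  the lattice. In this form an operator and its fibres are indexed alike and can be compared and
  truncated term by term.\<close>

lemma fiber_weighted_sum:
  fixes a :: "(nat \<Rightarrow> int) \<Rightarrow> 'a ell2_op"
  assumes \<rho>: "(\<lambda>x. cmod (\<rho> x)) summable_on X" and a: "\<And>z. norm (a z) \<le> 1"
  shows "(\<Sum>\<^sub>\<infinity>z\<in>X'. nu j \<tau>' (mu N \<tau> \<rho>) z *\<^sub>C a z)
    = (\<Sum>\<^sub>\<infinity>x\<in>X. (\<rho> x * phase \<tau> \<tau>' x) *\<^sub>C a (proj x))"
proof -
  \<comment> \<open>the terms of the double sum in \<open>nu j \<tau>' (mu N \<tau> \<rho>) z\<close>\<close>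
  define s where "s z l k = wave \<tau>' l * (wave \<tau> k * \<rho> (join k l z))" for z l k
  define D :: "((nat \<Rightarrow> int) \<times> int \<times> int) set" where "D = X' \<times> UNIV \<times> UNIV"
  let ?w = "\<lambda>x. \<rho> x * phase \<tau> \<tau>' x"
  have bij: "bij_betw (\<lambda>(z, l, k). join k l z) D X"
    by (rule bij_betw_byWitness[where f' = "\<lambda>x. (proj x, gap x, x 1)"])
      (auto simp: D_def proj_join gap_join join_1[unfolded One_nat_def] join_1 proj_in join_in
        join_coordinates[unfolded One_nat_def] join_coordinates)
  have w: "(\<lambda>x. cmod (?w x)) summable_on X"
    using \<rho> by (simp add: norm_mult norm_phase)
  have s_eq: "?w (join k l z) = s z l k" if "z \<in> X'" for z l k
    using that by (simp add: s_def phase_def gap_join join_1[unfolded One_nat_def] join_1)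
  have s_summable: "(\<lambda>(z, l, k). s z l k) summable_on D"
  proof -
    have "(\<lambda>(z, l, k). ?w (join k l z)) summable_on D"
      using abs_summable_summable[OF w] summable_on_reindex_bij_betw[OF bij, of ?w]
      by (simp add: case_prod_unfold)
    then show ?thesis
      by (rule summable_on_cong[THEN iffD1, rotated]) (auto simp: D_def s_eq)
  qed
  have s_z: "(\<lambda>(l, k). s z l k) summable_on UNIV \<times> UNIV" if "z \<in> X'" for z
    using summable_on_SigmaD1[of "\<lambda>z (l, k). s z l k" X' "\<lambda>_. UNIV \<times> UNIV" z] s_summable that
    by (simp add: D_def)
  have nu_eq: "nu j \<tau>' (mu N \<tau> \<rho>) z = (\<Sum>\<^sub>\<infinity>(l, k)\<in>UNIV \<times> UNIV. s z l k)" if "z \<in> X'" for z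
  proof -
    have "nu j \<tau>' (mu N \<tau> \<rho>) z = (\<Sum>\<^sub>\<infinity>l. \<Sum>\<^sub>\<infinity>k. s z l k)"
      by (simp add: nu_def mu_def s_def wave_def join_def infsum_cmult_right')
    also have "\<dots> = (\<Sum>\<^sub>\<infinity>(l, k)\<in>UNIV \<times> UNIV. s z l k)"
      by (rule infsum_Sigma'_banach[OF s_z[OF that]])
    finally show ?thesis .
  qed
  have op_summable: "(\<lambda>(z, l, k). s z l k *\<^sub>C a z) summable_on D"
  proof -
    have "(\<lambda>x. ?w x *\<^sub>C a (proj x)) summable_on X"
      by (rule weighted_summable[OF w a])
    then have "(\<lambda>(z, l, k). ?w (join k l z) *\<^sub>C a (proj (join k l z))) summable_on D"
      using summable_on_reindex_bij_betw[OF bij, of "\<lambda>x. ?w x *\<^sub>C a (proj x)"]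
      by (simp add: case_prod_unfold)
    then show ?thesis
      by (rule summable_on_cong[THEN iffD1, rotated]) (auto simp: D_def s_eq proj_join)
  qed
  have "(\<Sum>\<^sub>\<infinity>z\<in>X'. nu j \<tau>' (mu N \<tau> \<rho>) z *\<^sub>C a z)
      = (\<Sum>\<^sub>\<infinity>z\<in>X'. \<Sum>\<^sub>\<infinity>(l, k)\<in>UNIV \<times> UNIV. s z l k *\<^sub>C a z)"
  proof (rule infsum_cong)
    fix z assume "z \<in> X'"
    then show "nu j \<tau>' (mu N \<tau> \<rho>) z *\<^sub>C a z = (\<Sum>\<^sub>\<infinity>(l, k)\<in>UNIV \<times> UNIV. s z l k *\<^sub>C a z)"
      using infsum_bounded_linear[OF bounded_linear_scaleC_op s_z, of z "a z"]
      by (simp add: nu_eq case_prod_unfold)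
  qed
  also have "\<dots> = (\<Sum>\<^sub>\<infinity>(z, l, k)\<in>D. s z l k *\<^sub>C a z)"
    unfolding D_def
    by (rule infsum_Sigma'_banach[of "\<lambda>z (l, k). s z l k *\<^sub>C a z"])
      (use op_summable in \<open>simp add: D_def\<close>)
  also have "\<dots> = (\<Sum>\<^sub>\<infinity>(z, l, k)\<in>D. ?w (join k l z) *\<^sub>C a (proj (join k l z)))"
    by (rule infsum_cong) (auto simp: D_def s_eq proj_join)
  also have "\<dots> = (\<Sum>\<^sub>\<infinity>x\<in>X. ?w x *\<^sub>C a (proj x))"
    using infsum_reindex_bij_betw[OF bij, of "\<lambda>x. ?w x *\<^sub>C a (proj x)"]
    by (simp add: case_prod_unfold)
  finally show ?thesis .
qed

end

section \<open>The Bloch transform\<close>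

context lattice_gap
begin

text \<open>The partial Fourier transform of the restriction of \<open>f\<close> to a finite set \<open>S\<close>: the variables \<open>x 1\<close> and
  \<open>gap x\<close> are replaced by the momenta \<open>\<tau>\<close> and \<open>\<tau>'\<close>, and what remains is a function on the fibre lattice.\<close>

definition Bloch :: "(nat \<Rightarrow> int) set \<Rightarrow> real \<Rightarrow> real \<Rightarrow> (nat \<Rightarrow> int) ell2 \<Rightarrow> (nat \<Rightarrow> int) ell2" where
  "Bloch S \<tau> \<tau>' f = (\<Sum>x\<in>S. scaleC_ell2 (phase \<tau> \<tau>' x * ell2_apply f x) (ket (proj x)))"

lemma Bloch_add: "Bloch S \<tau> \<tau>' (f + g) = Bloch S \<tau> \<tau>' f + Bloch S \<tau> \<tau>' g"
  unfolding Bloch_def sum.distrib[symmetric]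
  by (intro sum.cong ell2_eqI) (auto simp: algebra_simps)

lemma Bloch_scaleC: "Bloch S \<tau> \<tau>' (scaleC_ell2 c f) = scaleC_ell2 c (Bloch S \<tau> \<tau>' f)"
  unfolding Bloch_def scaleC_ell2_sum
  by (intro sum.cong ell2_eqI) (auto simp: algebra_simps)

lemma Bloch_scaleR: "Bloch S \<tau> \<tau>' (c *\<^sub>R f) = c *\<^sub>R Bloch S \<tau> \<tau>' f"
  by (metis Bloch_scaleC scaleC_ell2_of_real)

lemma Bloch_sum: "Bloch S \<tau> \<tau>' (\<Sum>i\<in>F. g i) = (\<Sum>i\<in>F. Bloch S \<tau> \<tau>' (g i))"
proof -
  have "Bloch S \<tau> \<tau>' 0 = 0"
    using Bloch_scaleR[of S \<tau> \<tau>' 0 0] by simp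
  then show ?thesis
    by (induction F rule: infinite_finite_induct) (simp_all add: Bloch_add)
qed

lemma sum_phase:
  assumes "\<bar>w 1\<bar> < int L" "\<bar>gap w\<bar> < int L"
  shows "(\<Sum>m<L. \<Sum>m'<L. phase (real m / real L) (real m' / real L) w)
    = (if w 1 = 0 \<and> gap w = 0 then (of_nat L)\<^sup>2 else 0)"
proof -
  have "(\<Sum>m<L. \<Sum>m'<L. phase (real m / real L) (real m' / real L) w)
      = (\<Sum>m<L. wave (real m / real L) (w 1)) * (\<Sum>m'<L. wave (real m' / real L) (gap w))"
    by (simp add: phase_def sum_product)
  then show ?thesis
    unfolding sum_wave[OF assms(1)] sum_wave[OF assms(2)] by (simp add: power2_eq_square)
qed

lemma phase_diff: "phase \<tau> \<tau>' (y - x) = cnj (phase \<tau> \<tau>' x) * phase \<tau> \<tau>' y"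
  using phase_add[of \<tau> \<tau>' y "- x"] by (simp add: phase_uminus)

text \<open>In the squared norm of the transform, the cross term of \<open>x\<close> and \<open>y\<close> carries the phase of \<open>y - x\<close>
  and is present only when \<open>proj x = proj y\<close>. Summation over the grid of momenta kills it unless \<open>x\<close>
  and \<open>y\<close> also agree in the first coordinate and in the gap, that is unless \<open>x = y\<close>; no aliasing
  occurs because \<open>L\<close> exceeds all differences in \<open>S\<close>.\<close>

lemma Bloch_Parseval:
  assumes S: "finite S" "S \<subseteq> X"
    and L: "\<And>x y. x \<in> S \<Longrightarrow> y \<in> S \<Longrightarrow> \<bar>y 1 - x 1\<bar> < int L \<and> \<bar>gap y - gap x\<bar> < int L"
    and f: "\<And>x. ell2_apply f x \<noteq> 0 \<Longrightarrow> x \<in> S"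
  shows "(\<Sum>m<L. \<Sum>m'<L. (norm (Bloch S (real m / real L) (real m' / real L) f))\<^sup>2)
    = (real L)\<^sup>2 * (norm f)\<^sup>2"
proof -
  define t where "t m = real m / real L" for m
  define c where "c x y = (if proj x = proj y then cnj (ell2_apply f x) * ell2_apply f y else 0)" for x y
  have norm_Bloch: "(norm (Bloch S \<tau> \<tau>' f))\<^sup>2 = (\<Sum>x\<in>S. \<Sum>y\<in>S. Re (c x y * phase \<tau> \<tau>' (y - x)))"
    for \<tau> \<tau>'
    unfolding power2_norm_eq_inner Bloch_def inner_sum_left inner_sum_right inner_scaleC_ket c_def
    by (intro sum.cong refl) (auto simp: phase_diff algebra_simps)
  have "(\<Sum>m<L. \<Sum>m'<L. (norm (Bloch S (t m) (t m') f))\<^sup>2)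
      = (\<Sum>x\<in>S. \<Sum>y\<in>S. \<Sum>m<L. \<Sum>m'<L. Re (c x y * phase (t m) (t m') (y - x)))"
  proof -
    have "(\<Sum>m<L. \<Sum>m'<L. \<Sum>x\<in>S. \<Sum>y\<in>S. g m m' x y) = (\<Sum>x\<in>S. \<Sum>y\<in>S. \<Sum>m<L. \<Sum>m'<L. g m m' x y)"
      for g :: "nat \<Rightarrow> nat \<Rightarrow> (nat \<Rightarrow> int) \<Rightarrow> (nat \<Rightarrow> int) \<Rightarrow> real"
    proof -
      have "(\<Sum>m<L. \<Sum>m'<L. \<Sum>x\<in>S. \<Sum>y\<in>S. g m m' x y) = (\<Sum>m<L. \<Sum>x\<in>S. \<Sum>m'<L. \<Sum>y\<in>S. g m m' x y)"
        by (intro sum.cong refl sum.swap)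
      also have "\<dots> = (\<Sum>x\<in>S. \<Sum>m<L. \<Sum>y\<in>S. \<Sum>m'<L. g m m' x y)"
        by (subst sum.swap) (intro sum.cong refl sum.swap)
      also have "\<dots> = (\<Sum>x\<in>S. \<Sum>y\<in>S. \<Sum>m<L. \<Sum>m'<L. g m m' x y)"
        by (intro sum.cong refl sum.swap)
      finally show ?thesis .
    qed
    then show ?thesis
      unfolding norm_Bloch .
  qed
  also have "\<dots> = (\<Sum>x\<in>S. \<Sum>y\<in>S. Re (c x y * (\<Sum>m<L. \<Sum>m'<L. phase (t m) (t m') (y - x))))"
    by (simp add: sum_distrib_left)
  also have "\<dots> = (\<Sum>x\<in>S. \<Sum>y\<in>S. if x = y then (real L)\<^sup>2 * (cmod (ell2_apply f x))\<^sup>2 else 0)"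
  proof (intro sum.cong refl)
    fix x y assume xy: "x \<in> S" "y \<in> S"
    have sum: "(\<Sum>m<L. \<Sum>m'<L. phase (t m) (t m') (y - x))
        = (if (y - x) 1 = 0 \<and> gap (y - x) = 0 then (of_nat L)\<^sup>2 else 0)"
      unfolding t_def by (rule sum_phase) (use L[OF xy] in \<open>auto simp: gap_diff\<close>)
    show "Re (c x y * (\<Sum>m<L. \<Sum>m'<L. phase (t m) (t m') (y - x)))
        = (if x = y then (real L)\<^sup>2 * (cmod (ell2_apply f x))\<^sup>2 else 0)"
    proof (cases "x = y")
      case True
      have "c x x = complex_of_real ((cmod (ell2_apply f x))\<^sup>2)"
        unfolding c_def complex_norm_square by (simp add: mult.commute)
      then have "c x y * (\<Sum>m<L. \<Sum>m'<L. phase (t m) (t m') (y - x))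
          = complex_of_real ((real L)\<^sup>2 * (cmod (ell2_apply f x))\<^sup>2)"
        unfolding sum using True by (simp add: gap_def)
      then show ?thesis
        using True by (simp only: Re_complex_of_real simp_thms if_True)
    next
      case False
      then have "c x y = 0" if "(y - x) 1 = 0" "gap (y - x) = 0"
        using coordinates_inj[of x y] that xy S(2) by (auto simp: c_def gap_diff)
      then show ?thesis
        unfolding sum using False by auto
    qed
  qed
  also have "\<dots> = (real L)\<^sup>2 * (norm f)\<^sup>2"
    using S(1) by (simp add: norm_sq_finite_support[OF S(1) f] sum_distrib_left)
  finally show ?thesis
    by (simp add: t_def)
qed

text \<open>The lower bound \<open>m\<close> on the gap records how far the support is from the boundary that the fibres do
  not see.\<close>

definition supported :: "(nat \<Rightarrow> int) set \<Rightarrow> int \<Rightarrow> (nat \<Rightarrow> int) ell2 \<Rightarrow> bool" where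
  "supported T m f \<longleftrightarrow> (\<forall>x. ell2_apply f x \<noteq> 0 \<longrightarrow> x \<in> T \<and> x \<in> X \<and> m \<le> gap x)"

definition grow :: "(nat \<Rightarrow> int) set \<Rightarrow> (nat \<Rightarrow> int) set \<Rightarrow> (nat \<Rightarrow> int) set" where
  "grow F T = T \<union> (\<lambda>(x, \<eta>). x + \<eta>) ` (T \<times> F)"

lemma subset_grow: "T \<subseteq> grow F T"
  by (auto simp: grow_def)

lemma grow_mono: "i \<le> k \<Longrightarrow> (grow F ^^ i) T \<subseteq> (grow F ^^ k) T"
  by (induction k rule: dec_induct) (use subset_grow in auto)

lemma grow_in_X: "F \<subseteq> X \<Longrightarrow> T \<subseteq> X \<Longrightarrow> (grow F ^^ i) T \<subseteq> X"
  by (induction i) (auto simp: grow_def intro: X_add)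

lemma finite_grow: "finite F \<Longrightarrow> finite T \<Longrightarrow> finite ((grow F ^^ i) T)"
  by (induction i) (auto simp: grow_def)

text \<open>Both the source \<open>x\<close> and the target \<open>x + \<eta>\<close> have positive gap as long as \<open>\<bar>gap \<eta>\<bar> < m\<close>. Membership of
  either point in the ordered cone is then decided by its projection, and the translation only
  contributes its phase.\<close>

lemma Bloch_compressed_shift:
  assumes f: "supported T m f" and \<eta>: "\<eta> \<in> X" "\<bar>gap \<eta>\<bar> < m" and T: "T \<subseteq> S" "(\<lambda>x. x + \<eta>) ` T \<subseteq> S"
    and S: "finite S"
  shows "Bloch S \<tau> \<tau>' (compressed_shift E \<eta> f)
    = scaleC_ell2 (phase \<tau> \<tau>' \<eta>) (compressed_shift E' (proj \<eta>) (Bloch S \<tau> \<tau>' f))"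
proof -
  let ?c = "compressed_shift E' (proj \<eta>)"
  have lin: "?c (scaleC_ell2 c g) = scaleC_ell2 c (?c g)" for c g
    by (rule bounded_op_inD(1)[OF bounded_op_in_compressed_shift])
  have cone: "x \<in> E \<longleftrightarrow> proj x \<in> E'" "x + \<eta> \<in> E \<longleftrightarrow> proj x + proj \<eta> \<in> E'"
    if "ell2_apply f x \<noteq> 0" for x
  proof -
    have "x \<in> X" "m \<le> gap x"
      using f that by (auto simp: supported_def)
    then show "x \<in> E \<longleftrightarrow> proj x \<in> E'" "x + \<eta> \<in> E \<longleftrightarrow> proj x + proj \<eta> \<in> E'"
      using \<eta> X_add[OF \<open>x \<in> X\<close> \<eta>(1)] by (auto simp: in_ordered_cone_iff gap_add proj_add)
  qed
  have "Bloch S \<tau> \<tau>' (compressed_shift E \<eta> f) = (\<Sum>x\<in>(\<lambda>x. x + \<eta>) ` T.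
      scaleC_ell2 (phase \<tau> \<tau>' x * ell2_apply (compressed_shift E \<eta> f) x) (ket (proj x)))"
    unfolding Bloch_def
  proof (rule sum.mono_neutral_right[OF S T(2)], intro ballI)
    fix x assume x: "x \<in> S - (\<lambda>x. x + \<eta>) ` T"
    have "x - \<eta> \<notin> T"
    proof
      assume "x - \<eta> \<in> T"
      then have "(x - \<eta>) + \<eta> \<in> (\<lambda>x. x + \<eta>) ` T"
        by (rule imageI)
      then show False
        using x by simp
    qed
    then have "ell2_apply f (x - \<eta>) = 0"
      using f by (auto simp: supported_def)
    then show "scaleC_ell2 (phase \<tau> \<tau>' x * ell2_apply (compressed_shift E \<eta> f) x) (ket (proj x)) = 0"
      by (simp add: ell2_apply_compressed_shift scaleC_ell2_0)
  qed
  also have "\<dots> = (\<Sum>x\<in>T. scaleC_ell2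
      (phase \<tau> \<tau>' (x + \<eta>) * ell2_apply (compressed_shift E \<eta> f) (x + \<eta>)) (ket (proj (x + \<eta>))))"
    by (subst sum.reindex) (auto intro: inj_onI)
  also have "\<dots> = (\<Sum>x\<in>T. scaleC_ell2 (phase \<tau> \<tau>' \<eta>)
      (?c (scaleC_ell2 (phase \<tau> \<tau>' x * ell2_apply f x) (ket (proj x)))))"
  proof (rule sum.cong[OF refl])
    fix x assume "x \<in> T"
    show "scaleC_ell2 (phase \<tau> \<tau>' (x + \<eta>) * ell2_apply (compressed_shift E \<eta> f) (x + \<eta>)) (ket (proj (x + \<eta>)))
      = scaleC_ell2 (phase \<tau> \<tau>' \<eta>) (?c (scaleC_ell2 (phase \<tau> \<tau>' x * ell2_apply f x) (ket (proj x))))"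
      using cone[of x]
      by (cases "ell2_apply f x = 0")
        (auto simp: ell2_apply_compressed_shift compressed_shift_ket lin scaleC_ell2_0
          scaleC_ell2_scaleC phase_add proj_add mult_ac)
  qed
  also have "\<dots> = (\<Sum>x\<in>S. scaleC_ell2 (phase \<tau> \<tau>' \<eta>)
      (?c (scaleC_ell2 (phase \<tau> \<tau>' x * ell2_apply f x) (ket (proj x)))))"
  proof (rule sum.mono_neutral_left[OF S T(1)], intro ballI)
    fix x assume "x \<in> S - T"
    then have "ell2_apply f x = 0"
      using f by (auto simp: supported_def)
    then show "scaleC_ell2 (phase \<tau> \<tau>' \<eta>)
        (?c (scaleC_ell2 (phase \<tau> \<tau>' x * ell2_apply f x) (ket (proj x)))) = 0"
      by (simp add: scaleC_ell2_0)
  qed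
  also have "\<dots> = scaleC_ell2 (phase \<tau> \<tau>' \<eta>) (?c (Bloch S \<tau> \<tau>' f))"
    by (simp add: Bloch_def blinfun.sum_right scaleC_ell2_sum)
  finally show ?thesis .
qed

text \<open>Multiplication operators do not move points and so contribute no phase. This is why \<open>\<psi>\<close> enters the
  fibres with both momenta equal to 0.\<close>

lemma Bloch_overlap:
  assumes f: "supported T m f" and \<eta>: "\<eta> \<in> X" "\<bar>gap \<eta>\<bar> < m"
  shows "Bloch S \<tau> \<tau>' (chi (overlap E \<eta>) f) = chi (overlap E' (proj \<eta>)) (Bloch S \<tau> \<tau>' f)"
proof -
  have eq: "x \<in> overlap E \<eta> \<longleftrightarrow> proj x \<in> overlap E' (proj \<eta>)" if "ell2_apply f x \<noteq> 0" for x
  proof -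
    have "x \<in> X" "m \<le> gap x"
      using f that by (auto simp: supported_def)
    then show ?thesis
      using \<eta> X_diff[OF \<open>x \<in> X\<close> \<eta>(1)] by (auto simp: overlap_def in_ordered_cone_iff gap_diff proj_diff)
  qed
  show ?thesis
    unfolding Bloch_def blinfun.sum_right
  proof (rule sum.cong[OF refl])
    fix x
    show "scaleC_ell2 (phase \<tau> \<tau>' x * ell2_apply (chi (overlap E \<eta>) f) x) (ket (proj x))
      = chi (overlap E' (proj \<eta>)) (scaleC_ell2 (phase \<tau> \<tau>' x * ell2_apply f x) (ket (proj x)))"
      using eq[of x] by (cases "ell2_apply f x = 0")
        (simp_all add: scaleC_ell2_0 chi_ket flip: scaleC_chi_ell2)
  qed
qed

end

section \<open>The operator, its fibres and its truncations\<close>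

locale gap_hamiltonian = lattice_gap +
  fixes \<phi> \<psi> :: "(nat \<Rightarrow> int) \<Rightarrow> complex"
  assumes \<phi>: "(\<lambda>x. cmod (\<phi> x)) summable_on X" and \<phi>_real: "\<And>x. x \<in> X \<Longrightarrow> \<phi> x \<in> \<real>"
    and \<psi>: "(\<lambda>x. cmod (\<psi> x)) summable_on X" and \<psi>_real: "\<And>x. x \<in> X \<Longrightarrow> \<psi> x \<in> \<real>"
    and sym: "symmetric_op (toeplitz_T X E \<phi> + toeplitz_V X E \<psi>)"
begin

definition "Ham = toeplitz_T X E \<phi> + toeplitz_V X E \<psi>"

definition "H_fiber \<tau> \<tau>' =
  toeplitz_T X' E' (nu j \<tau>' (mu N \<tau> \<phi>)) + toeplitz_V X' E' (nu j 0 (mu N 0 \<psi>))"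

definition "H_trunc F = (\<Sum>x\<in>F. \<phi> x *\<^sub>C compressed_shift E x) + (\<Sum>x\<in>F. \<psi> x *\<^sub>C chi (overlap E x))"

definition "H_fiber_trunc F \<tau> \<tau>' =
  (\<Sum>x\<in>F. (\<phi> x * phase \<tau> \<tau>' x) *\<^sub>C compressed_shift E' (proj x))
  + (\<Sum>x\<in>F. \<psi> x *\<^sub>C chi (overlap E' (proj x)))"

lemma H_eq: "Ham = (\<Sum>\<^sub>\<infinity>x\<in>X. \<phi> x *\<^sub>C compressed_shift E x) + (\<Sum>\<^sub>\<infinity>x\<in>X. \<psi> x *\<^sub>C chi (overlap E x))"
  by (simp add: Ham_def toeplitz_T_def toeplitz_V_eq)

lemma H_fiber_eq: "H_fiber \<tau> \<tau>' =
    (\<Sum>\<^sub>\<infinity>x\<in>X. (\<phi> x * phase \<tau> \<tau>' x) *\<^sub>C compressed_shift E' (proj x))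
    + (\<Sum>\<^sub>\<infinity>x\<in>X. \<psi> x *\<^sub>C chi (overlap E' (proj x)))"
  unfolding H_fiber_def toeplitz_T_def toeplitz_V_eq fiber_weighted_sum[OF \<phi> norm_compressed_shift_le]
    fiber_weighted_sum[OF \<psi> norm_chi_le]
  by (simp add: phase_0)

lemma \<phi>_phase: "(\<lambda>x. cmod (\<phi> x * phase \<tau> \<tau>' x)) summable_on X"
  using \<phi> by (simp add: norm_mult norm_phase)

lemma bounded_op_in_H: "bounded_op_in E Ham"
  unfolding H_eq
  by (intro bounded_op_in_add bounded_op_in_weighted_sum \<phi> \<psi> norm_compressed_shift_le norm_chi_le
      bounded_op_in_compressed_shift bounded_op_in_chi) (auto simp: overlap_def)

lemma bounded_op_in_H_fiber: "bounded_op_in E' (H_fiber \<tau> \<tau>')"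
  unfolding H_fiber_eq
  by (intro bounded_op_in_add bounded_op_in_weighted_sum \<phi>_phase \<psi> norm_compressed_shift_le
      norm_chi_le bounded_op_in_compressed_shift bounded_op_in_chi) (auto simp: overlap_def)

lemma bounded_op_in_H_trunc: "bounded_op_in E (H_trunc F)"
  unfolding H_trunc_def
  by (intro bounded_op_in_add bounded_op_in_sum bounded_op_in_scaleC
      bounded_op_in_compressed_shift bounded_op_in_chi) (auto simp: overlap_def)

lemma bounded_op_in_H_fiber_trunc: "bounded_op_in E' (H_fiber_trunc F \<tau> \<tau>')"
  unfolding H_fiber_trunc_def
  by (intro bounded_op_in_add bounded_op_in_sum bounded_op_in_scaleC
      bounded_op_in_compressed_shift bounded_op_in_chi) (auto simp: overlap_def)

text \<open>A common bound for the norms of the operator and all of its fibres.\<close>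

definition "coeff_norm = (\<Sum>\<^sub>\<infinity>x\<in>X. cmod (\<phi> x)) + (\<Sum>\<^sub>\<infinity>x\<in>X. cmod (\<psi> x))"

lemma norm_H_le: "norm Ham \<le> coeff_norm"
  unfolding H_eq coeff_norm_def
  by (intro norm_triangle_mono norm_weighted_sum_le \<phi> \<psi> norm_compressed_shift_le norm_chi_le)

lemma norm_H_fiber_le: "norm (H_fiber \<tau> \<tau>') \<le> coeff_norm"
proof -
  have "norm (\<Sum>\<^sub>\<infinity>x\<in>X. (\<phi> x * phase \<tau> \<tau>' x) *\<^sub>C compressed_shift E' (proj x))
      \<le> (\<Sum>\<^sub>\<infinity>x\<in>X. cmod (\<phi> x * phase \<tau> \<tau>' x))"
    by (rule norm_weighted_sum_le[OF \<phi>_phase norm_compressed_shift_le])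
  then show ?thesis
    unfolding H_fiber_eq coeff_norm_def
    by (intro norm_triangle_mono norm_weighted_sum_le \<psi> norm_chi_le)
      (simp add: norm_mult norm_phase)
qed

lemma finite_truncation:
  assumes "\<delta> > 0"
  obtains F where "finite F" "F \<subseteq> X" "norm (Ham - H_trunc F) \<le> \<delta>"
    "\<And>\<tau> \<tau>'. norm (H_fiber \<tau> \<tau>' - H_fiber_trunc F \<tau> \<tau>') \<le> \<delta>"
proof -
  define w where "w x = cmod (\<phi> x) + cmod (\<psi> x)" for x
  have "w summable_on X"
    unfolding w_def by (intro summable_on_add \<phi> \<psi>)
  then obtain F where F: "finite F" "F \<subseteq> X" and "infsum w X - sum w F \<le> \<delta>"
    using finite_small_tail assms by blast
  moreover have "infsum w X - sum w F = ((\<Sum>\<^sub>\<infinity>x\<in>X. cmod (\<phi> x)) - (\<Sum>x\<in>F. cmod (\<phi> x)))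
      + ((\<Sum>\<^sub>\<infinity>x\<in>X. cmod (\<psi> x)) - (\<Sum>x\<in>F. cmod (\<psi> x)))"
    using infsum_add[OF \<phi> \<psi>] by (simp add: w_def[abs_def] sum.distrib)
  ultimately have small: "((\<Sum>\<^sub>\<infinity>x\<in>X. cmod (\<phi> x)) - (\<Sum>x\<in>F. cmod (\<phi> x)))
      + ((\<Sum>\<^sub>\<infinity>x\<in>X. cmod (\<psi> x)) - (\<Sum>x\<in>F. cmod (\<psi> x))) \<le> \<delta>"
    by simp
  have split: "norm ((a + b) - (c + d)) \<le> \<delta>"
    if "norm (a - c) \<le> (\<Sum>\<^sub>\<infinity>x\<in>X. cmod (\<phi> x)) - (\<Sum>x\<in>F. cmod (\<phi> x))"
      "norm (b - d) \<le> (\<Sum>\<^sub>\<infinity>x\<in>X. cmod (\<psi> x)) - (\<Sum>x\<in>F. cmod (\<psi> x))"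
    for a b c d :: "(nat \<Rightarrow> int) ell2_op"
    using norm_triangle_mono[OF that] small by (simp add: algebra_simps)
  show ?thesis
  proof (rule that[OF F])
    show "norm (Ham - H_trunc F) \<le> \<delta>"
      unfolding H_eq H_trunc_def
      by (intro split norm_weighted_sum_tail_le \<phi> \<psi> F norm_compressed_shift_le norm_chi_le order_refl)
    show "norm (H_fiber \<tau> \<tau>' - H_fiber_trunc F \<tau> \<tau>') \<le> \<delta>" for \<tau> \<tau>'
      unfolding H_fiber_eq H_fiber_trunc_def
      by (intro split norm_weighted_sum_tail_le \<phi> \<psi> F norm_compressed_shift_le norm_chi_le order_refl)
        (simp add: norm_mult norm_phase)
  qed
qed

text \<open>The point \<open>v\<close> with increments \<open>1 + \<bar>\<zeta>\<^sub>i\<bar>\<close>, where \<open>\<zeta>\<^sub>i\<close> are the increments of \<open>x\<close>, lies in the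
  cone, and so does \<open>v + x\<close>.\<close>

lemma difference_of_cone:
  assumes "x \<in> X"
  obtains u v where "u \<in> E" "v \<in> E" "u - v = x"
proof -
  define \<zeta> where "\<zeta> i = x i - x (i - 1)" for i
  define v where "v = theta_inv N (\<lambda>i. 1 + \<bar>\<zeta> i\<bar>)"
  have v_X: "v \<in> X"
    by (simp add: X_def v_def theta_inv_def int_lattice_def)
  have step: "v (Suc i) - v i = 1 + \<bar>x (Suc i) - x i\<bar>" if "i \<in> {1..<N}" for i
    using theta_inv_diff[of "Suc i" "\<lambda>i. 1 + \<bar>\<zeta> i\<bar>"] that by (simp add: v_def \<zeta>_def)
  have "v \<in> E"
    unfolding ordered_cone_def X_def[symmetric] using v_X step by fastforce
  moreover have "v + x \<in> E"
    unfolding ordered_cone_def X_def[symmetric] using X_add[OF v_X assms] step by fastforce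
  ultimately show ?thesis
    using that[of "v + x" v] by simp
qed

text \<open>Every \<open>x\<close> is a difference \<open>u - v\<close> of points of the cone, so \<open>\<phi>(x)\<close> and \<open>\<phi>(- x)\<close> are the two
  off-diagonal matrix elements between \<open>u\<close> and \<open>v\<close>, where multiplication operators contribute
  nothing.\<close>

lemma \<phi>_even:
  assumes x: "x \<in> X"
  shows "\<phi> (- x) = \<phi> x"
proof (cases "x = 0")
  case False
  obtain u v where uv: "u \<in> E" "v \<in> E" "u - v = x"
    by (rule difference_of_cone[OF x])
  have vu: "v - u = - x" and "u \<noteq> v" "v \<noteq> u"
    using uv(3) False by auto
  have "ket u \<bullet> Ham (ket v) = ket v \<bullet> Ham (ket u)"
    using sym symmetric_opD[of Ham "ket u" "ket v"] by (simp add: Ham_def inner_commute)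
  then have "Re (\<phi> (u - v)) = Re (\<phi> (v - u))"
    using \<open>u \<noteq> v\<close> \<open>v \<noteq> u\<close> x X_uminus[OF x] uv vu
    by (simp add: Ham_def blinfun.add_left inner_add_right inner_ket_toeplitz_T_ket[OF \<phi>]
        inner_ket_toeplitz_V_ket[OF \<psi>])
  then show ?thesis
    using \<phi>_real[OF x] \<phi>_real[OF X_uminus[OF x]] uv(3) vu by (auto simp: complex_is_Real_iff complex_eq_iff)
qed simp

text \<open>Symmetry passes to the fibres through the coefficients: \<open>\<phi>\<close> is real and even, and the phase is
  conjugated under negation.\<close>

lemma symmetric_H_fiber: "symmetric_op (H_fiber \<tau> \<tau>')"
  unfolding H_fiber_eq
proof (rule symmetric_add)
  show "symmetric_op (\<Sum>\<^sub>\<infinity>x\<in>X. (\<phi> x * phase \<tau> \<tau>' x) *\<^sub>C compressed_shift E' (proj x))"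
  proof (rule symmetric_op_weighted_sum[OF \<phi>_phase norm_compressed_shift_le, where \<sigma> = uminus])
    fix x assume x: "x \<in> X"
    show "\<phi> (- x) * phase \<tau> \<tau>' (- x) = cnj (\<phi> x * phase \<tau> \<tau>' x)"
      using \<phi>_real[OF x] by (simp add: \<phi>_even[OF x] phase_uminus Reals_cnj_iff)
  qed (auto simp: proj_uminus inner_compressed_shift X_uminus
      bounded_op_inD(1)[OF bounded_op_in_compressed_shift])
  show "symmetric_op (\<Sum>\<^sub>\<infinity>x\<in>X. \<psi> x *\<^sub>C chi (overlap E' (proj x)))"
    by (rule symmetric_op_weighted_sum[OF \<psi> norm_chi_le, where \<sigma> = "\<lambda>x. x"])
      (use \<psi>_real in \<open>auto simp: inner_chi_ell2 scaleC_chi_ell2 Reals_cnj_iff\<close>)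
qed

lemma ell2_apply_H_trunc: "ell2_apply (H_trunc F f) x =
    (\<Sum>\<eta>\<in>F. \<phi> \<eta> * (if x \<in> E \<and> x - \<eta> \<in> E then ell2_apply f (x - \<eta>) else 0))
    + (\<Sum>\<eta>\<in>F. \<psi> \<eta> * (if x \<in> overlap E \<eta> then ell2_apply f x else 0))"
  by (simp add: H_trunc_def blinfun.add_left blinfun.sum_left ell2_apply_sum ell2_apply_compressed_shift)

lemma supported_H_trunc:
  assumes f: "supported T m f" and F: "F \<subseteq> X" and r: "\<And>\<eta>. \<eta> \<in> F \<Longrightarrow> \<bar>gap \<eta>\<bar> \<le> r" "0 \<le> r"
  shows "supported (grow F T) (m - r) (H_trunc F f)"
  unfolding supported_def
proof (intro allI impI)
  fix x
  assume "ell2_apply (H_trunc F f) x \<noteq> 0"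
  then have "\<not> ((\<forall>\<eta>\<in>F. ell2_apply f (x - \<eta>) = 0) \<and> ell2_apply f x = 0)"
    by (auto simp: ell2_apply_H_trunc cong: if_cong sum.cong)
  then consider (T) \<eta> where "\<eta> \<in> F" "ell2_apply f (x - \<eta>) \<noteq> 0" | (V) "ell2_apply f x \<noteq> 0"
    by blast
  then show "x \<in> grow F T \<and> x \<in> X \<and> m - r \<le> gap x"
  proof cases
    case T
    then have *: "x - \<eta> \<in> T" "x - \<eta> \<in> X" "m \<le> gap (x - \<eta>)"
      using f by (auto simp: supported_def)
    have "x = (x - \<eta>) + \<eta>"
      by simp
    then have "x \<in> grow F T" "x \<in> X"
      using * T(1) F X_add[of "x - \<eta>" \<eta>] by (force simp: grow_def, auto)
    then show ?thesis
      using * r(1)[OF T(1)] by (simp add: gap_diff)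
  next
    case V
    then show ?thesis
      using f r(2) by (fastforce simp: supported_def grow_def)
  qed
qed

text \<open>One application of the truncated operator lowers the gap by at most \<open>r\<close>, so it is intertwined
  exactly as long as the support keeps a distance larger than \<open>r\<close> from the boundary.\<close>

lemma Bloch_H_trunc:
  assumes f: "supported T m f" and F: "finite F" "F \<subseteq> X"
    and r: "\<And>\<eta>. \<eta> \<in> F \<Longrightarrow> \<bar>gap \<eta>\<bar> \<le> r" "r < m"
    and S: "finite S" "grow F T \<subseteq> S"
  shows "Bloch S \<tau> \<tau>' (H_trunc F f) = H_fiber_trunc F \<tau> \<tau>' (Bloch S \<tau> \<tau>' f)"
proof -
  have T: "T \<subseteq> S" "(\<lambda>x. x + \<eta>) ` T \<subseteq> S" if "\<eta> \<in> F" for \<eta>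
    using S(2) that by (auto simp: grow_def)
  have "Bloch S \<tau> \<tau>' (compressed_shift E \<eta> f)
      = scaleC_ell2 (phase \<tau> \<tau>' \<eta>) (compressed_shift E' (proj \<eta>) (Bloch S \<tau> \<tau>' f))"
    "Bloch S \<tau> \<tau>' (chi_ell2 (overlap E \<eta>) f) = chi_ell2 (overlap E' (proj \<eta>)) (Bloch S \<tau> \<tau>' f)"
    if "\<eta> \<in> F" for \<eta>
    using Bloch_compressed_shift[OF f _ _ T[OF that] S(1)] Bloch_overlap[OF f] r(1)[OF that] r(2) F(2) that
    by auto
  then show ?thesis
    unfolding H_trunc_def H_fiber_trunc_def
    by (simp add: blinfun.add_left blinfun.sum_left Bloch_add Bloch_sum Bloch_scaleC scaleC_ell2_scaleC)
qed

text \<open>Induction over the powers: the \<open>i\<close>-th power spreads the support to \<open>i\<close> translations and costs \<open>i r\<close>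
  of the gap, so all powers up to \<open>degree p\<close> stay clear of the boundary.\<close>

lemma Bloch_poly_op_H_trunc:
  assumes f: "supported T m f" "m \<ge> 1" "chi_ell2 E f = f"
    and F: "finite F" "F \<subseteq> X" and T: "finite T"
    and r: "\<And>\<eta>. \<eta> \<in> F \<Longrightarrow> \<bar>gap \<eta>\<bar> \<le> r" "0 \<le> r" "int (degree p) * r < m"
    and S: "finite S" "(grow F ^^ degree p) T \<subseteq> S"
  shows "Bloch S \<tau> \<tau>' (poly_op E p (H_trunc F) f)
      = poly_op E' p (H_fiber_trunc F \<tau> \<tau>') (Bloch S \<tau> \<tau>' f)" (is ?thesis1)
    and "supported ((grow F ^^ degree p) T) 0 (poly_op E p (H_trunc F) f)" (is ?thesis2)
proof -
  define g where "g i = ((\<lambda>B. H_trunc F o\<^sub>L B) ^^ i) (chi E) f" for i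
  define h where "h i = ((\<lambda>B. H_fiber_trunc F \<tau> \<tau>' o\<^sub>L B) ^^ i) (chi E') (Bloch S \<tau> \<tau>' f)" for i
  have "chi_ell2 E' (Bloch S \<tau> \<tau>' f) = Bloch S \<tau> \<tau>' f"
  proof -
    have "x \<in> X \<and> x \<in> E" if "ell2_apply f x \<noteq> 0" for x
      using f(1) that arg_cong[OF f(3), of "\<lambda>f. ell2_apply f x"]
      by (auto simp: supported_def split: if_splits)
    then have proj: "proj x \<in> E'" if "ell2_apply f x \<noteq> 0" for x
      using that in_ordered_cone_iff by blast
    show ?thesis
      unfolding Bloch_def chi_apply[symmetric] blinfun.sum_right
    proof (rule sum.cong[OF refl])
      fix x
      show "chi E' (scaleC_ell2 (phase \<tau> \<tau>' x * ell2_apply f x) (ket (proj x)))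
        = scaleC_ell2 (phase \<tau> \<tau>' x * ell2_apply f x) (ket (proj x))"
        using proj[of x] by (cases "ell2_apply f x = 0")
          (simp_all add: scaleC_ell2_0 chi_ket flip: scaleC_chi_ell2)
    qed
  qed
  then have gh0: "g 0 = f" "h 0 = Bloch S \<tau> \<tau>' f"
    using f(3) by (simp_all add: g_def h_def)
  have gh_Suc: "g (Suc i) = H_trunc F (g i)" "h (Suc i) = H_fiber_trunc F \<tau> \<tau>' (h i)" for i
    by (simp_all add: g_def h_def)
  have main: "supported ((grow F ^^ i) T) (m - int i * r) (g i) \<and> Bloch S \<tau> \<tau>' (g i) = h i"
    if "i \<le> degree p" for i
    using that
  proof (induction i)
    case 0
    then show ?case
      using f(1) by (simp add: gh0)
  next
    case (Suc i)
    then have sup: "supported ((grow F ^^ i) T) (m - int i * r) (g i)" and B: "Bloch S \<tau> \<tau>' (g i) = h i"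
      by simp_all
    have "int (Suc i) * r \<le> int (degree p) * r"
      using Suc.prems r(2) by (intro mult_right_mono) auto
    then have "r < m - int i * r"
      using r(3) by (simp add: algebra_simps)
    moreover have "grow F ((grow F ^^ i) T) \<subseteq> S"
      using grow_mono[OF Suc.prems, of F T] S(2) by auto
    ultimately have "Bloch S \<tau> \<tau>' (g (Suc i)) = h (Suc i)"
      unfolding gh_Suc using Bloch_H_trunc[OF sup F r(1) _ S(1)] B by auto
    moreover have "supported ((grow F ^^ Suc i) T) (m - int (Suc i) * r) (g (Suc i))"
      using supported_H_trunc[OF sup F(2) r(1,2)] by (simp add: gh_Suc algebra_simps)
    ultimately show ?case
      by blast
  qed
  show ?thesis1
    using main unfolding poly_op_apply g_def[symmetric] h_def[symmetric]
    by (simp add: Bloch_sum Bloch_scaleR)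
  show ?thesis2
    unfolding supported_def
  proof (intro allI impI)
    fix x assume "ell2_apply (poly_op E p (H_trunc F) f) x \<noteq> 0"
    then obtain i where i: "i \<le> degree p" "ell2_apply (g i) x \<noteq> 0"
      unfolding poly_op_apply g_def[symmetric] ell2_apply_sum
      by (metis (no_types, lifting) atMost_iff ell2_apply_scaleR scaleR_zero_right sum.neutral)
    have "int i * r \<le> int (degree p) * r"
      using i(1) r(2) by (intro mult_right_mono) auto
    then show "x \<in> (grow F ^^ degree p) T \<and> x \<in> X \<and> 0 \<le> gap x"
      using main[OF i(1)] i(2) grow_mono[OF i(1), of F T] r(3) by (fastforce simp: supported_def)
  qed
qed

section \<open>Localization away from the fibre spectra\<close>

text \<open>On finitely supported functions the grid average of the Bloch transforms reproduces norms before and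
  after the application of \<open>p\<close>, while on each fibre \<open>p\<close> contracts by the factor \<open>C\<close>.\<close>

lemma norm_poly_op_H_trunc_Omega_le:
  assumes F: "finite F" "F \<subseteq> X" and r: "\<And>\<eta>. \<eta> \<in> F \<Longrightarrow> \<bar>gap \<eta>\<bar> \<le> r" "0 \<le> r"
    and n: "int (degree p) * r < int n" and C: "0 \<le> C"
    and le: "\<And>\<tau> \<tau>'. \<tau> \<in> {0..1} \<Longrightarrow> \<tau>' \<in> {0..1} \<Longrightarrow> norm (poly_op E' p (H_fiber_trunc F \<tau> \<tau>')) \<le> C"
  shows "norm (poly_op E p (H_trunc F) o\<^sub>L chi (Omega N j n)) \<le> C"
proof (rule norm_blinfun_bound[OF C], rule norm_apply_le_of_finite)
  fix f :: "(nat \<Rightarrow> int) ell2" and S0 :: "(nat \<Rightarrow> int) set"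
  assume S0: "finite S0"
  define g where "g = chi_ell2 (Omega N j n) (chi_ell2 S0 f)"
  define pg where "pg = poly_op E p (H_trunc F) g"
  define T where "T = S0 \<inter> Omega N j n"
  define S where "S = (grow F ^^ degree p) T"
  have Omega: "Omega N j n \<subseteq> E" "E \<subseteq> X" "\<And>x. x \<in> Omega N j n \<Longrightarrow> int n \<le> gap x"
    by (auto simp: Omega_def gap_def ordered_cone_def X_def)
  have T: "finite T" "T \<subseteq> X"
    using S0 Omega by (auto simp: T_def)
  have S: "finite S" "S \<subseteq> X" "T \<subseteq> S"
    using finite_grow[OF F(1) T(1)] grow_in_X[OF F(2) T(2)] grow_mono[of 0 "degree p" F T]
    by (auto simp: S_def)
  have g: "supported T (int n) g"
    using Omega T(2) by (auto simp: supported_def g_def T_def split: if_splits)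
  have chi_g: "chi_ell2 E g = g"
    by (rule ell2_eqI) (use Omega(1) in \<open>auto simp: g_def\<close>)
  have "0 \<le> int (degree p) * r"
    using r(2) by simp
  then have n1: "int n \<ge> 1"
    using n by linarith
  have Bloch: "Bloch S \<tau> \<tau>' pg = poly_op E' p (H_fiber_trunc F \<tau> \<tau>') (Bloch S \<tau> \<tau>' g)" for \<tau> \<tau>'
    unfolding pg_def by (rule Bloch_poly_op_H_trunc(1)[OF g n1 chi_g F T(1) r n S(1)]) (simp_all add: S_def)
  have "supported S 0 pg"
    unfolding pg_def S_def
    by (rule Bloch_poly_op_H_trunc(2)[OF g n1 chi_g F T(1) r n S(1)]) (simp_all add: S_def)
  then have supp_pg: "x \<in> S" if "ell2_apply pg x \<noteq> 0" for x
    using that by (auto simp: supported_def)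
  have supp_g: "x \<in> S" if "ell2_apply g x \<noteq> 0" for x
    using that g S(3) by (auto simp: supported_def)
  \<comment> \<open>\<open>L\<close> exceeds all differences of first coordinates and of gaps within \<open>S\<close>.\<close>
  define D where "D = (\<Sum>x\<in>S. \<bar>x 1\<bar> + \<bar>gap x\<bar>)"
  define L where "L = nat (2 * D + 1)"
  have D: "\<bar>x 1\<bar> + \<bar>gap x\<bar> \<le> D" if "x \<in> S" for x
    unfolding D_def by (rule member_le_sum[OF that _ S(1)]) simp
  have "0 \<le> D"
    by (simp add: D_def sum_nonneg)
  then have int_L: "int L = 2 * D + 1"
    by (simp add: L_def)
  then have "L > 0"
    using \<open>0 \<le> D\<close> by (cases L) auto
  have L: "\<bar>y 1 - x 1\<bar> < int L \<and> \<bar>gap y - gap x\<bar> < int L" if "x \<in> S" "y \<in> S" for x y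
    unfolding int_L using D[OF that(1)] D[OF that(2)] by auto
  note Parseval = Bloch_Parseval[OF S(1,2) L]
  have "(real L)\<^sup>2 * (norm pg)\<^sup>2
      = (\<Sum>m<L. \<Sum>m'<L. (norm (Bloch S (real m / real L) (real m' / real L) pg))\<^sup>2)"
    by (rule Parseval[OF _ _ supp_pg, symmetric])
  also have "\<dots> \<le> (\<Sum>m<L. \<Sum>m'<L. C\<^sup>2 * (norm (Bloch S (real m / real L) (real m' / real L) g))\<^sup>2)"
  proof (intro sum_mono)
    fix m m' assume "m \<in> {..<L}" "m' \<in> {..<L}"
    then have t: "real m / real L \<in> {0..1}" "real m' / real L \<in> {0..1}"
      by auto
    have "norm (Bloch S (real m / real L) (real m' / real L) pg)
        \<le> C * norm (Bloch S (real m / real L) (real m' / real L) g)"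
      unfolding Bloch by (rule order_trans[OF norm_blinfun mult_right_mono[OF le[OF t]]]) simp
    then have "(norm (Bloch S (real m / real L) (real m' / real L) pg))\<^sup>2
        \<le> (C * norm (Bloch S (real m / real L) (real m' / real L) g))\<^sup>2"
      by (rule power_mono) simp
    then show "(norm (Bloch S (real m / real L) (real m' / real L) pg))\<^sup>2
        \<le> C\<^sup>2 * (norm (Bloch S (real m / real L) (real m' / real L) g))\<^sup>2"
      by (simp only: power_mult_distrib)
  qed
  also have "\<dots> = C\<^sup>2 * (\<Sum>m<L. \<Sum>m'<L. (norm (Bloch S (real m / real L) (real m' / real L) g))\<^sup>2)"
    by (simp only: sum_distrib_left)
  also have "(\<Sum>m<L. \<Sum>m'<L. (norm (Bloch S (real m / real L) (real m' / real L) g))\<^sup>2)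
      = (real L)\<^sup>2 * (norm g)\<^sup>2"
    by (rule Parseval[OF _ _ supp_g])
  finally have "(norm pg)\<^sup>2 \<le> (C * norm g)\<^sup>2"
    using \<open>L > 0\<close> by (simp add: power_mult_distrib mult.left_commute)
  then have "norm pg \<le> C * norm g"
    by (rule power2_le_imp_le) (use C in simp)
  also have "\<dots> \<le> C * norm f"
    unfolding g_def by (intro mult_left_mono order_trans[OF norm_chi_ell2_le] norm_chi_ell2_le C)
  finally show "norm ((poly_op E p (H_trunc F) o\<^sub>L chi (Omega N j n)) (chi_ell2 S0 f)) \<le> C * norm f"
    by (simp add: pg_def g_def)
qed

text \<open>The four errors of size \<open>\<delta>\<close> come from replacing \<open>\<kappa>\<close> by \<open>p\<close>, from truncating \<open>p(H)\<close>, from truncating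
  the fibres, and from the norm of \<open>p\<close> on the fibres.\<close>

theorem fun_calc_small_at_large_gap:
  assumes cont: "continuous_on UNIV \<kappa>"
    and \<kappa>: "\<And>t \<tau> \<tau>'. \<tau> \<in> {0..1} \<Longrightarrow> \<tau>' \<in> {0..1} \<Longrightarrow>
      complex_of_real t \<in> spectrum_in E' (H_fiber \<tau> \<tau>') \<Longrightarrow> \<kappa> t = 0"
    and "\<epsilon> > 0"
  shows "\<exists>n\<^sub>0. \<forall>n\<ge>n\<^sub>0. norm (chi (Omega N j n) o\<^sub>L fun_calc E \<kappa> Ham) \<le> \<epsilon>"
proof -
  define \<delta> where "\<delta> = \<epsilon> / 4"
  have \<delta>: "\<delta> > 0"
    using \<open>\<epsilon> > 0\<close> by (simp add: \<delta>_def)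
  have nonneg: "0 \<le> coeff_norm"
    using norm_H_le norm_ge_zero order_trans by blast
  obtain p :: "real poly" where p: "\<And>t. \<bar>t\<bar> \<le> coeff_norm \<Longrightarrow> \<bar>poly p t - \<kappa> t\<bar> < \<delta>"
    using Weierstrass_poly[OF cont \<delta>] by blast
  have calc: "norm (fun_calc E \<kappa> Ham - poly_op E p Ham) \<le> \<delta>"
    by (rule norm_fun_calc_diff_poly_op_le[OF bounded_op_in_H _ cont norm_H_le])
      (use sym p in \<open>auto simp: Ham_def less_imp_le\<close>)
  have fiber: "norm (poly_op E' p (H_fiber \<tau> \<tau>')) \<le> \<delta>" if \<tau>: "\<tau> \<in> {0..1}" "\<tau>' \<in> {0..1}" for \<tau> \<tau>'
  proof -
    interpret fib: operator_on E' "H_fiber \<tau> \<tau>'"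
      by (rule operator_onI[OF bounded_op_in_H_fiber])
    show ?thesis
    proof (rule fib.norm_poly_op_le[OF symmetric_H_fiber])
      fix t assume t: "complex_of_real t \<in> spectrum_in E' (H_fiber \<tau> \<tau>')"
      then have "\<bar>t\<bar> \<le> coeff_norm"
        using fib.Neumann_resolvent[OF bounded_op_inD(1)[OF bounded_op_in_H_fiber], of t]
          norm_H_fiber_le[of \<tau> \<tau>'] by fastforce
      then show "\<bar>poly p t\<bar> \<le> \<delta>"
        using p[of t] \<kappa>[OF \<tau> t] by simp
    qed (use \<delta> in simp)
  qed
  obtain K where K: "0 \<le> K" and Lip: "\<forall>G (A :: (nat \<Rightarrow> int) ell2_op) B. operator_on G A \<longrightarrow>
      operator_on G B \<longrightarrow> norm A \<le> coeff_norm + 1 \<longrightarrow> norm B \<le> coeff_norm + 1 \<longrightarrow>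
      norm (poly_op G p A - poly_op G p B) \<le> K * norm (A - B)"
    using poly_op_Lipschitz[of "coeff_norm + 1" p] nonneg by auto
  \<comment> \<open>The bound 1 keeps the truncated operators in the ball of radius \<open>coeff_norm + 1\<close>, on which \<open>K\<close>
    is a Lipschitz constant.\<close>
  define \<eta> where "\<eta> = min 1 (\<delta> / (K + 1))"
  have \<eta>: "\<eta> > 0" "\<eta> \<le> 1" "K * \<eta> \<le> \<delta>"
  proof -
    have "K * \<eta> \<le> K * (\<delta> / (K + 1))"
      using K by (intro mult_left_mono) (auto simp: \<eta>_def)
    also have "\<dots> \<le> \<delta>"
      using K \<delta> by (simp add: field_simps)
    finally show "K * \<eta> \<le> \<delta>" .
  qed (use K \<delta> in \<open>auto simp: \<eta>_def\<close>)
  have close: "norm (poly_op G p A - poly_op G p B) \<le> \<delta>"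
    if "bounded_op_in G A" "bounded_op_in G B" "norm A \<le> coeff_norm" "norm (A - B) \<le> \<eta>"
    for G and A B :: "(nat \<Rightarrow> int) ell2_op"
  proof -
    have B: "norm A \<le> coeff_norm + 1" "norm B \<le> coeff_norm + 1"
      using that(3,4) \<eta>(2) norm_triangle_sub[of B A] norm_minus_commute[of A B] by linarith+
    then have "norm (poly_op G p A - poly_op G p B) \<le> K * norm (A - B)"
      using Lip operator_onI[OF that(1)] operator_onI[OF that(2)] B by blast
    also have "\<dots> \<le> K * \<eta>"
      using K that(4) by (rule mult_left_mono[rotated])
    finally show ?thesis
      using \<eta>(3) by simp
  qed
  obtain F where F: "finite F" "F \<subseteq> X" "norm (Ham - H_trunc F) \<le> \<eta>"
    "\<And>\<tau> \<tau>'. norm (H_fiber \<tau> \<tau>' - H_fiber_trunc F \<tau> \<tau>') \<le> \<eta>"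
    using finite_truncation[OF \<eta>(1)] by blast
  define r where "r = (\<Sum>x\<in>F. \<bar>gap x\<bar>)"
  have r: "0 \<le> r" "\<And>x. x \<in> F \<Longrightarrow> \<bar>gap x\<bar> \<le> r"
    unfolding r_def using F(1) by (auto intro: sum_nonneg member_le_sum)
  have fiber_trunc: "norm (poly_op E' p (H_fiber_trunc F \<tau> \<tau>')) \<le> 2 * \<delta>"
    if "\<tau> \<in> {0..1}" "\<tau>' \<in> {0..1}" for \<tau> \<tau>'
    using fiber[OF that]
      close[OF bounded_op_in_H_fiber bounded_op_in_H_fiber_trunc norm_H_fiber_le F(4), of \<tau> \<tau>']
      norm_triangle_sub[of "poly_op E' p (H_fiber_trunc F \<tau> \<tau>')" "poly_op E' p (H_fiber \<tau> \<tau>')"]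
      norm_minus_commute[of "poly_op E' p (H_fiber_trunc F \<tau> \<tau>')" "poly_op E' p (H_fiber \<tau> \<tau>')"]
    by linarith
  have "norm (chi (Omega N j n) o\<^sub>L fun_calc E \<kappa> Ham) \<le> \<epsilon>"
    if n: "nat (int (degree p) * r) + 1 \<le> n" for n
  proof -
    let ?\<chi> = "chi (Omega N j n)"
    have contr: "norm (?\<chi> o\<^sub>L A) \<le> norm A" "norm (A o\<^sub>L ?\<chi>) \<le> norm A" for A :: "(nat \<Rightarrow> int) ell2_op"
      using norm_blinfun_compose[of ?\<chi> A] mult_right_mono[OF norm_chi_le[of "Omega N j n"] norm_ge_zero[of A]]
        norm_blinfun_compose[of A ?\<chi>] mult_left_mono[OF norm_chi_le[of "Omega N j n"] norm_ge_zero[of A]]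
      by linarith+
    have "norm (poly_op E p (H_trunc F) o\<^sub>L ?\<chi>) \<le> 2 * \<delta>"
      by (rule norm_poly_op_H_trunc_Omega_le[OF F(1,2) r(2,1) _ _ fiber_trunc]) (use n \<delta> in auto)
    moreover have "norm ((poly_op E p Ham - poly_op E p (H_trunc F)) o\<^sub>L ?\<chi>) \<le> \<delta>"
      using contr(2) close[OF bounded_op_in_H bounded_op_in_H_trunc norm_H_le F(3)] order_trans by blast
    ultimately have "norm (poly_op E p Ham o\<^sub>L ?\<chi>) \<le> 3 * \<delta>"
      using norm_triangle_sub[of "poly_op E p Ham o\<^sub>L ?\<chi>" "poly_op E p (H_trunc F) o\<^sub>L ?\<chi>"]
      by (simp add: comp_diff_left)
    moreover have "symmetric_op (poly_op E p Ham)"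
      using operator_on.symmetric_poly_op[OF operator_onI[OF bounded_op_in_H]] sym by (simp add: Ham_def)
    ultimately have "norm (?\<chi> o\<^sub>L poly_op E p Ham) \<le> 3 * \<delta>"
      using norm_chi_comp_symmetric_le order_trans by blast
    moreover have "norm (?\<chi> o\<^sub>L (fun_calc E \<kappa> Ham - poly_op E p Ham)) \<le> \<delta>"
      using contr(1) calc order_trans by blast
    ultimately have "norm (?\<chi> o\<^sub>L fun_calc E \<kappa> Ham) \<le> 4 * \<delta>"
      using norm_triangle_sub[of "?\<chi> o\<^sub>L fun_calc E \<kappa> Ham" "?\<chi> o\<^sub>L poly_op E p Ham"]
      by (simp add: comp_diff_right)
    then show ?thesis
      by (simp add: \<delta>_def)
  qed
  then show ?thesis
    by blast
qed

end

theorem theorem5p1: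
  fixes N j :: nat
    and \<phi> \<psi> :: "(nat \<Rightarrow> int) \<Rightarrow> complex"
    and \<kappa> :: "real \<Rightarrow> real"
  defines "H \<equiv> toeplitz_T (int_lattice {1..N}) (ordered_cone N) \<phi>
              + toeplitz_V (int_lattice {1..N}) (ordered_cone N) \<psi>"
  assumes "N \<ge> 2" and "j \<in> {2..N}"
    and "(\<lambda>x. cmod (\<phi> x)) summable_on int_lattice {1..N}" and "\<forall>x\<in>int_lattice {1..N}. \<phi> x \<in> \<real>"
    and "(\<lambda>x. cmod (\<psi> x)) summable_on int_lattice {1..N}" and "\<forall>x\<in>int_lattice {1..N}. \<psi> x \<in> \<real>"
    and "selfadjoint H"
    and "continuous_on UNIV \<kappa>"
    and "complex_of_real ` closure {t. \<kappa> t \<noteq> 0} \<inter>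
         (\<Union>\<tau>\<in>{0..1}. \<Union>\<tau>'\<in>{0..1}. fiber_spectrum N j \<phi> \<psi> \<tau> \<tau>') = {}"
  shows "\<forall>\<epsilon>>0. \<exists>n\<^sub>\<epsilon>::nat. \<forall>n\<ge>n\<^sub>\<epsilon>.
    norm (chi (Omega N j n) o\<^sub>L fun_calc (ordered_cone N) \<kappa> H) \<le> \<epsilon>"
proof -
  interpret gap: lattice_gap N j
    by unfold_locales (use assms(3) in auto)
  interpret gap_hamiltonian N j \<phi> \<psi>
  proof unfold_locales
    show "symmetric_op (toeplitz_T gap.X (ordered_cone N) \<phi> + toeplitz_V gap.X (ordered_cone N) \<psi>)"
      using selfadjoint_imp_symmetric_op[OF assms(8)] by (simp only: H_def gap.X_def)
  qed (use assms(4-7) in \<open>simp_all only: gap.X_def\<close>)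
  have H: "Ham = H"
    by (simp only: H_def Ham_def gap.X_def)
  have "\<kappa> t = 0" if "\<tau> \<in> {0..1}" "\<tau>' \<in> {0..1}"
    "complex_of_real t \<in> spectrum_in (positive_cone gap.rest) (H_fiber \<tau> \<tau>')" for t \<tau> \<tau>'
  proof (rule ccontr)
    assume "\<kappa> t \<noteq> 0"
    then have "t \<in> closure {t. \<kappa> t \<noteq> 0}"
      by (intro closure_subset[THEN subsetD]) simp
    moreover have "complex_of_real t \<in> fiber_spectrum N j \<phi> \<psi> \<tau> \<tau>'"
      using that(3) unfolding fiber_spectrum_def Let_def H_fiber_def gap.rest_def .
    ultimately show False
      using assms(10) that(1,2) by blast
  qed
  then show ?thesis
    using fun_calc_small_at_large_gap[OF assms(9)] unfolding H by simp
qed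

end
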